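(* Consider the one-type frog model on $\mathbb{Z}^d$ ($d\ge1$) started from the origin. Assume that the initial distribution $\nu$ satisfies $\mathbb{P}(\eta(x)\geq n)\geq (\log n)^{-\delta}$ for some positive $\delta<d$ and all $n$ large enough. Then, for any fixed $p\in(0,1]$, the limit shape satisfies $\mathcal{A}(\nu,p)=\mathcal{D}$, where $\mathcal{D}=\{x\in\mathbb{R}^d:\|x\|_1\leq 1\}$.
   Context: One-type frog model on $\mathbb{Z}^d$ with jump probability $p\in(0,1]$. Let $\{\eta(x)\}_{x\in\mathbb{Z}^d}$ be i.i.d. random variables with values in $\{0,1,2,\dots\}$; $\eta(x)$ is the initial number of particles at $x$, and $\nu$ denotes the product measure given by this initial particle distribution. Independently, each particle $(x,j)$ ($1\le j\le\eta(x)$) has its own independent simple symmetric nearest-neighbour random walk path on $\mathbb{Z}^d$ started at $x$ and its own independent lazy clock. At time 0 the particles at the origin are active and all other particles are sleeping. In each discrete time step, every active particle independently jumps to the next site of its random walk path with probability $p$ and stays put with probability $1-p$. When an active particle visits a site, all sleeping particles there are activated and start moving (from the next time step on). A site is discovered when it is first hit by an active particle (the origin is discovered at time 0). $\xi_n(p)\subset\mathbb{Z}^d$ denotes the set of sites discovered up to time $n$, and $\bar{\xi}_n(p)=\bigcup_{x\in\xi_n(p)}\big(x+(-1/2,1/2]^d\big)\subset\mathbb{R}^d$. Limit shape: $\mathcal{A}(\nu,p)$ denotes the (closed) non-empty convex set such that, conditional on $\eta(\mathbf{0})\ge1$, for any $\varepsilon\in(0,1)$, almost surely $(1-\varepsilon)\mathcal{A}(\nu,p)\subset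 \bar\xi_n(p)/n\subset(1+\varepsilon)\mathcal{A}(\nu,p)$ for all sufficiently large $n$ (such a set exists by the shape theorem for the model). $\|\cdot\|_1$ is the $L_1$-norm. *)

theory Defs
  imports "HOL-Probability.Probability"
begin

text \<open>
  The dimension of the lattice is \<open>CARD('d)\<close>. A sample consists of the initial particle numbers
  and, for each particle \<open>(x, j)\<close>, of the increments of its random walk path and the ticks of its
  lazy clock. The data of a particle \<open>(x, j)\<close> is used only if \<open>1 \<le> j \<le> \<eta>(x)\<close>.
\<close>

type_synonym 'd site = "int ^ 'd"

type_synonym 'd sample =
  "('d site \<Rightarrow> nat) \<times> ('d site \<times> nat \<times> nat \<Rightarrow> 'd site) \<times> ('d site \<times> nat \<times> nat \<Rightarrow> bool)"

definition unit_steps :: "(int ^ 'd::finite) set" where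
  "unit_steps = {axis i s | i s. s = 1 \<or> s = - 1}"

definition initial_measure :: "nat pmf \<Rightarrow> ('d::finite site \<Rightarrow> nat) measure" where
  "initial_measure \<mu> = (\<Pi>\<^sub>M x\<in>UNIV. measure_pmf \<mu>)"

definition frog_measure :: "nat pmf \<Rightarrow> real \<Rightarrow> 'd::finite sample measure" where
  "frog_measure \<mu> p =
     initial_measure \<mu> \<Otimes>\<^sub>M
     ((\<Pi>\<^sub>M i\<in>UNIV. measure_pmf (pmf_of_set unit_steps)) \<Otimes>\<^sub>M
      (\<Pi>\<^sub>M i\<in>UNIV. measure_pmf (bernoulli_pmf p)))"

definition init_particles :: "'d::finite sample \<Rightarrow> 'd site \<Rightarrow> nat" where
  "init_particles \<omega> x = fst \<omega> x"

definition walk_increment :: "'d::finite sample \<Rightarrow> 'd site \<Rightarrow> nat \<Rightarrow> nat \<Rightarrow> 'd site" where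
  "walk_increment \<omega> x j m = fst (snd \<omega>) (x, j, m)"

definition clock_tick :: "'d::finite sample \<Rightarrow> 'd site \<Rightarrow> nat \<Rightarrow> nat \<Rightarrow> bool" where
  "clock_tick \<omega> x j k = snd (snd \<omega>) (x, j, k)"

definition walk_path :: "'d::finite sample \<Rightarrow> 'd site \<Rightarrow> nat \<Rightarrow> nat \<Rightarrow> 'd site" where
  "walk_path \<omega> x j m = x + (\<Sum>i<m. walk_increment \<omega> x j i)"

definition num_jumps :: "'d::finite sample \<Rightarrow> 'd site \<Rightarrow> nat \<Rightarrow> nat \<Rightarrow> nat" where
  "num_jumps \<omega> x j k = card {i. i < k \<and> clock_tick \<omega> x j i}"

text \<open>The clock of a particle runs from its activation: \<open>k\<close> counts the time steps since then.\<close>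

definition particle_position :: "'d::finite sample \<Rightarrow> 'd site \<Rightarrow> nat \<Rightarrow> nat \<Rightarrow> 'd site" where
  "particle_position \<omega> x j k = walk_path \<omega> x j (num_jumps \<omega> x j k)"

text \<open>
  \<open>discovery \<omega> n x\<close> is \<open>Some t\<close> if \<open>x\<close> was discovered at time \<open>t \<le> n\<close>, and \<open>None\<close> if \<open>x\<close> has not
  been discovered up to time \<open>n\<close>. The particles initially at \<open>y\<close> become active when \<open>y\<close> is
  discovered, so that the active particles moving in step \<open>n + 1\<close> are those of the sites discovered
  up to time \<open>n\<close>.
\<close>

primrec discovery :: "'d::finite sample \<Rightarrow> nat \<Rightarrow> 'd site \<Rightarrow> nat option" where
  "discovery \<omega> 0 = (\<lambda>x. if x = 0 then Some 0 else None)"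
| "discovery \<omega> (Suc n) = (\<lambda>x.
     case discovery \<omega> n x of
       Some t \<Rightarrow> Some t
     | None \<Rightarrow>
         if \<exists>y t j. discovery \<omega> n y = Some t \<and> 1 \<le> j \<and> j \<le> init_particles \<omega> y \<and>
                    particle_position \<omega> y j (Suc n - t) = x
         then Some (Suc n) else None)"

definition discovered :: "'d::finite sample \<Rightarrow> nat \<Rightarrow> 'd site set" where
  "discovered \<omega> n = {x. discovery \<omega> n x \<noteq> None}"

definition discovered_region :: "'d::finite sample \<Rightarrow> nat \<Rightarrow> (real ^ 'd) set" where
  "discovered_region \<omega> n =
     (\<Union>x\<in>discovered \<omega> n. {y. \<forall>i. - 1/2 < y $ i - of_int (x $ i) \<and> y $ i - of_int (x $ i) \<le> 1/2})"

text \<open>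
  Conditioning on the event \<open>\<eta>(0) \<ge> 1\<close> is expressed by \<^const>\<open>uniform_measure\<close>, which is
  \<open>B \<mapsto> P(E \<inter> B) / P(E)\<close> for the event \<open>E\<close>.
\<close>

definition is_limit_shape :: "nat pmf \<Rightarrow> real \<Rightarrow> (real ^ 'd::finite) set \<Rightarrow> bool" where
  "is_limit_shape \<mu> p A \<longleftrightarrow>
     closed A \<and> convex A \<and> A \<noteq> {} \<and>
     (\<forall>\<epsilon>. 0 < \<epsilon> \<and> \<epsilon> < 1 \<longrightarrow>
       (AE \<omega> in uniform_measure (frog_measure \<mu> p)
                  {\<omega> \<in> space (frog_measure \<mu> p). init_particles \<omega> (0 :: 'd site) \<ge> 1}.
          \<forall>\<^sub>F n in sequentially.
            (\<lambda>a. (1 - \<epsilon>) *\<^sub>R a) ` A \<subseteq> (\<lambda>y. y /\<^sub>R real n) ` discovered_region \<omega> n \<and>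
            (\<lambda>y. y /\<^sub>R real n) ` discovered_region \<omega> n \<subseteq> (\<lambda>a. (1 + \<epsilon>) *\<^sub>R a) ` A))"

definition L1_norm :: "real ^ 'd::finite \<Rightarrow> real" where
  "L1_norm x = (\<Sum>i\<in>UNIV. \<bar>x $ i\<bar>)"

definition L1_unit_ball :: "(real ^ 'd::finite) set" where
  "L1_unit_ball = {x. L1_norm x \<le> 1}"

end

theory Submission imports Defs "HOL-Real_Asymp.Real_Asymp" begin

text \<open>
  A site with at least \<open>b ^ m\<close> particles, where \<open>b\<close> is large in terms of \<open>p\<close> and \<open>d\<close>, sends for every
  site at distance at most \<open>m\<close> a particle straight there, without a single pause, except with
  doubly exponentially small probability. Since \<open>\<delta> < d\<close>, a ball of radius \<open>r\<close> contains a site with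
  at least \<open>b ^ (L r)\<close> particles except with probability \<open>exp (- c r ^ (d - \<delta>))\<close>, for every fixed \<open>L\<close>.
  By Borel--Cantelli both hold from some scale on, simultaneously for all centres in a ball of polynomial
  radius. Hence, if \<open>T(m)\<close> is the time at which the ball of radius \<open>m\<close> around the origin is completely
  discovered, then \<open>T(m) \<le> T(r) + m + r\<close> for \<open>m \<le> (L - 1) r\<close>. This first gives \<open>T(m) \<le> 4 m + c\<close>, and then, with
  \<open>r \<approx> m / (L - 1)\<close> and \<open>L\<close> large, \<open>T(m) \<le> (1 + \<epsilon>) m + c\<close>; no shape theorem is needed.

  It remains to see that \<open>T\<close> is finite. The walk of the first particle at the origin is unbounded and
  therefore visits \<open>r ^ d\<close> distinct sites within distance \<open>r ^ d\<close>. As it is independent of the initial numbers, one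
  of these sites has at least \<open>b ^ r\<close> particles for all large \<open>r\<close>, and the spread from it, doubling the
  radius of the discovered ball repeatedly, reaches every site.
\<close>

section \<open>Lattice geometry\<close>

definition norm1 :: "'d::finite site \<Rightarrow> nat" where
  "norm1 x = (\<Sum>i\<in>UNIV. nat \<bar>x $ i\<bar>)"

definition lattice_ball :: "'d::finite site \<Rightarrow> nat \<Rightarrow> 'd site set" where
  "lattice_ball x r = {y. norm1 (y - x) \<le> r}"

lemma norm1_0 [simp]: "norm1 0 = 0"
  by (simp add: norm1_def)

lemma norm1_eq_0_iff [simp]: "norm1 x = 0 \<longleftrightarrow> x = 0"
  by (auto simp: norm1_def vec_eq_iff)

lemma norm1_minus_commute: "norm1 (x - y) = norm1 (y - x)"
  by (simp add: norm1_def abs_minus_commute)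

lemma norm1_minus [simp]: "norm1 (- x) = norm1 x"
  by (simp add: norm1_def)

lemma norm1_triangle: "norm1 (x + y) \<le> norm1 x + norm1 y"
  unfolding norm1_def sum.distrib[symmetric] by (rule sum_mono) simp

lemma norm1_triangle_diff: "norm1 (x - z) \<le> norm1 (x - y) + norm1 (y - z)"
  using norm1_triangle[of "x - y" "y - z"] by simp

lemma norm1_unit_step: "u \<in> unit_steps \<Longrightarrow> norm1 u = 1"
proof -
  assume "u \<in> unit_steps"
  then obtain i s where u: "u = axis i s" "s = 1 \<or> s = - 1"
    by (auto simp: unit_steps_def)
  have "norm1 u = (\<Sum>j\<in>UNIV. if j = i then 1 else 0)"
    unfolding norm1_def using u by (intro sum.cong) (auto simp: axis_def)
  thus ?thesis by simp
qed

lemma norm1_sum_unit_steps: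
  assumes "\<And>i. i < k \<Longrightarrow> u i \<in> unit_steps"
  shows "norm1 (\<Sum>i<k. u i) \<le> k"
  using assms
proof (induction k)
  case (Suc k)
  have "norm1 (\<Sum>i<Suc k. u i) \<le> norm1 (\<Sum>i<k. u i) + norm1 (u k)"
    by (simp add: norm1_triangle)
  thus ?case using Suc by (simp add: norm1_unit_step)
qed simp

text \<open>Stepping back by the sign of any nonzero coordinate lowers that coordinate's absolute
  value by one and leaves all the others alone.\<close>

lemma closer_neighbour:
  fixes x :: "'d::finite site"
  assumes "norm1 x = Suc k"
  obtains u where "u \<in> unit_steps" "norm1 (x - u) = k"
proof -
  from assms obtain i where i: "x $ i \<noteq> 0"
    by (metis norm1_0 nat.distinct(1) vec_eq_iff zero_index)
  define u where "u = (axis i (sgn (x $ i)) :: 'd site)"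
  have u: "u \<in> unit_steps"
    using i by (auto simp: u_def unit_steps_def sgn_if)
  have "norm1 x = nat \<bar>x $ i\<bar> + (\<Sum>j\<in>UNIV - {i}. nat \<bar>x $ j\<bar>)"
    unfolding norm1_def by (rule sum.remove) auto
  moreover have "norm1 (x - u) = nat \<bar>(x - u) $ i\<bar> + (\<Sum>j\<in>UNIV - {i}. nat \<bar>(x - u) $ j\<bar>)"
    unfolding norm1_def by (rule sum.remove) auto
  moreover have "(\<Sum>j\<in>UNIV - {i}. nat \<bar>(x - u) $ j\<bar>) = (\<Sum>j\<in>UNIV - {i}. nat \<bar>x $ j\<bar>)"
    by (rule sum.cong) (auto simp: u_def axis_def)
  moreover have "nat \<bar>x $ i\<bar> = Suc (nat \<bar>(x - u) $ i\<bar>)"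
    using i by (auto simp: u_def axis_def sgn_if)
  ultimately have "norm1 (x - u) = k" using assms by simp
  with u show thesis by (rule that)
qed

lemma geodesic_exists:
  "\<exists>u. (\<forall>i. u i \<in> unit_steps) \<and> (\<Sum>i<norm1 x. u i) = x"
proof (induction "norm1 x" arbitrary: x)
  case 0
  obtain e :: "'a site" where "e \<in> unit_steps" unfolding unit_steps_def by blast
  with 0 show ?case by (intro exI[of _ "\<lambda>_. e"]) auto
next
  case (Suc k)
  from Suc(2)[symmetric] obtain v where v: "v \<in> unit_steps" "norm1 (x - v) = k"
    by (rule closer_neighbour)
  from Suc(1)[OF v(2)[symmetric]] obtain u where
    u: "\<forall>i. u i \<in> unit_steps" "(\<Sum>i<k. u i) = x - v" using v(2) by auto
  have "(\<Sum>i<Suc k. (u(k := v)) i) = x" using u(2) by simp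
  with u(1) v(1) Suc(2) show ?case by (intro exI[of _ "u(k := v)"]) auto
qed

text \<open>One fixed shortest path per displacement, so that following it is an explicit event. Its
  values are unit steps also beyond index \<open>norm1 x\<close>, which spares the probability
  estimates a side condition on the index.\<close>

definition geodesic :: "'d::finite site \<Rightarrow> nat \<Rightarrow> 'd site" where
  "geodesic x = (SOME u. (\<forall>i. u i \<in> unit_steps) \<and> (\<Sum>i<norm1 x. u i) = x)"

lemma geodesic_unit_steps: "geodesic x i \<in> unit_steps"
  and sum_geodesic: "(\<Sum>i<norm1 x. geodesic x i) = x"
  using someI_ex[OF geodesic_exists[of x]] unfolding geodesic_def by auto

section \<open>Counting lattice points in boxes and balls\<close>

lemma vec_box_eq: "{x::'a ^ 'd::finite. \<forall>i. x $ i \<in> A} = vec_lambda ` (UNIV \<rightarrow>\<^sub>E A)"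
proof (intro equalityI subsetI)
  fix x :: "'a ^ 'd" assume "x \<in> {x. \<forall>i. x $ i \<in> A}"
  hence "x = vec_lambda (vec_nth x)" "vec_nth x \<in> UNIV \<rightarrow>\<^sub>E A" by auto
  thus "x \<in> vec_lambda ` (UNIV \<rightarrow>\<^sub>E A)" by blast
qed auto

lemma finite_vec_box: "finite A \<Longrightarrow> finite {x::'a ^ 'd::finite. \<forall>i. x $ i \<in> A}"
  unfolding vec_box_eq by (intro finite_imageI finite_PiE) auto

lemma card_vec_box: "card {x::'a ^ 'd::finite. \<forall>i. x $ i \<in> A} = card A ^ CARD('d)"
proof -
  have "inj_on (vec_lambda :: ('d \<Rightarrow> 'a) \<Rightarrow> _) (UNIV \<rightarrow>\<^sub>E A)"
    by (auto intro!: inj_onI simp: vec_lambda_inject)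
  thus ?thesis unfolding vec_box_eq by (simp add: card_image card_PiE)
qed

lemma lattice_ball_0_subset_box:
  "lattice_ball (0::'d::finite site) r \<subseteq> {x. \<forall>i. x $ i \<in> {- int r..int r}}"
proof
  fix x :: "'d site" assume x: "x \<in> lattice_ball 0 r"
  have "\<bar>x $ i\<bar> \<le> int r" for i
  proof -
    have "nat \<bar>x $ i\<bar> \<le> norm1 x" unfolding norm1_def by (rule member_le_sum) auto
    with x show ?thesis by (auto simp: lattice_ball_def)
  qed
  thus "x \<in> {x. \<forall>i. x $ i \<in> {- int r..int r}}" by (auto simp: abs_le_iff) (metis minus_le_iff)
qed

lemma lattice_ball_translate: "lattice_ball x r = (+) x ` lattice_ball 0 r"
  by (auto simp: lattice_ball_def image_iff) (metis add_diff_cancel_left' add.commute diff_add_cancel)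

lemma finite_lattice_ball [simp]: "finite (lattice_ball x r)"
  unfolding lattice_ball_translate[of x]
  by (intro finite_imageI finite_subset[OF lattice_ball_0_subset_box] finite_vec_box) auto

lemma card_lattice_ball_le: "card (lattice_ball (x::'d::finite site) r) \<le> (2 * r + 1) ^ CARD('d)"
proof -
  have "card (lattice_ball x r) = card (lattice_ball (0::'d site) r)"
    unfolding lattice_ball_translate[of x] by (rule card_image) simp
  also have "\<dots> \<le> card {x::'d site. \<forall>i. x $ i \<in> {- int r..int r}}"
    by (intro card_mono finite_vec_box lattice_ball_0_subset_box) auto
  also have "\<dots> = (2 * r + 1) ^ CARD('d)"
    by (subst card_vec_box) (simp add: nat_add_distrib nat_mult_distrib)
  finally show ?thesis .
qed

lemma real_card_lattice_ball_le:
  "real (card (lattice_ball (x::'d::finite site) r)) \<le> (2 * real r + 1) ^ CARD('d)"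
proof -
  have "real (card (lattice_ball x r)) \<le> real ((2 * r + 1) ^ CARD('d))"
    by (simp only: of_nat_le_iff card_lattice_ball_le)
  thus ?thesis by (simp add: add.commute)
qed

text \<open>The cube with coordinates from 0 to \<open>r div d\<close> lies in the ball around 0,
  because d such coordinates sum to at most r. Each of its sides has \<open>r div d + 1\<close>
  points, which is at least r / d.\<close>

lemma card_lattice_ball_ge:
  "(real r / CARD('d)) ^ CARD('d) \<le> card (lattice_ball (x::'d::finite site) r)"
proof -
  let ?s = "r div CARD('d)"
  have sub: "{x::'d site. \<forall>i. x $ i \<in> {0..int ?s}} \<subseteq> lattice_ball 0 r"
  proof
    fix x :: "'d site" assume "x \<in> {x. \<forall>i. x $ i \<in> {0..int ?s}}"
    hence "norm1 x \<le> (\<Sum>i\<in>(UNIV::'d set). ?s)"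
      unfolding norm1_def by (intro sum_mono) (auto simp: nat_le_iff)
    also have "\<dots> \<le> r" by simp
    finally show "x \<in> lattice_ball 0 r" by (simp add: lattice_ball_def)
  qed
  have "real r / CARD('d) \<le> real ?s + 1"
  proof -
    have "r < CARD('d) * (?s + 1)" using mult_div_mod_eq[of "CARD('d)" r]
      by (metis Suc_eq_plus1 dividend_less_times_div mult_Suc_right zero_less_card_finite add.commute)
    hence "real r < real (CARD('d) * (?s + 1))" by (simp only: of_nat_less_iff)
    thus ?thesis by (simp add: field_simps)
  qed
  hence "(real r / CARD('d)) ^ CARD('d) \<le> (real ?s + 1) ^ CARD('d)"
    by (intro power_mono) auto
  also have "\<dots> = real (card {x::'d site. \<forall>i. x $ i \<in> {0..int ?s}})"
    by (subst card_vec_box) (simp add: nat_add_distrib add_ac)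
  also have "\<dots> \<le> card (lattice_ball (0::'d site) r)"
    using sub by (simp add: card_mono)
  also have "card (lattice_ball (0::'d site) r) = card (lattice_ball x r)"
    unfolding lattice_ball_translate[of x] by (rule card_image[symmetric]) simp
  finally show ?thesis .
qed


section \<open>Deterministic spread\<close>

lemma discovery_SucE:
  assumes "discovery \<omega> (Suc n) x = Some t"
  obtains "discovery \<omega> n x = Some t" | "t = Suc n"
  using assms that by (cases "discovery \<omega> n x") (simp_all split: if_splits)

lemma discovery_le: "discovery \<omega> n x = Some t \<Longrightarrow> t \<le> n"
proof (induction n)
  case (Suc n)
  from Suc.prems show ?case by (rule discovery_SucE) (use Suc.IH in auto)
qed (simp split: if_splits)

lemma discovery_mono: "discovery \<omega> n x = Some t \<Longrightarrow> n \<le> n' \<Longrightarrow> discovery \<omega> n' x = Some t"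
  by (rotate_tac, induction n' rule: dec_induct) auto

lemma discovered_mono: "n \<le> n' \<Longrightarrow> discovered \<omega> n \<subseteq> discovered \<omega> n'"
  unfolding discovered_def using discovery_mono by blast

lemma origin_discovered: "0 \<in> discovered \<omega> n"
  using discovery_mono[of \<omega> 0 0 0 n] by (simp add: discovered_def)

text \<open>A recorded discovery time never changes, so the state may be read at that very time.
  This allows a particle's clock to be started at its activation rather than at the time of
  observation.\<close>

lemma discovery_at_discovery_time: "discovery \<omega> n x = Some t \<Longrightarrow> discovery \<omega> t x = Some t"
proof (induction n)
  case (Suc n)
  from Suc.prems show ?case by (rule discovery_SucE) (use Suc in auto)
qed (simp split: if_splits)

lemma particle_position_0 [simp]: "particle_position \<omega> x j 0 = x"
  by (simp add: particle_position_def num_jumps_def walk_path_def)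

text \<open>If y was discovered at time t, its particles reach their k-th position by time t + k. As
  t is at most n, monotonicity gives n + k, and callers need not know the exact discovery
  time.\<close>

lemma discovered_step:
  assumes "y \<in> discovered \<omega> n" "1 \<le> j" "j \<le> init_particles \<omega> y"
  shows "particle_position \<omega> y j k \<in> discovered \<omega> (n + k)"
proof -
  from assms(1) obtain t where t: "discovery \<omega> n y = Some t" by (auto simp: discovered_def)
  have tn: "t \<le> n" using t by (rule discovery_le)
  have y: "discovery \<omega> m y = Some t" if "t \<le> m" for m
    using discovery_mono[OF discovery_at_discovery_time[OF t] that] .
  have "particle_position \<omega> y j k \<in> discovered \<omega> (t + k)"
  proof (cases k)
    case 0
    thus ?thesis using y[of t] by (simp add: discovered_def)
  next
    case (Suc l)
    have "discovery \<omega> (Suc (t + l)) (particle_position \<omega> y j k) \<noteq> None"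
    proof (cases "discovery \<omega> (t + l) (particle_position \<omega> y j k)")
      case None
      have "\<exists>y' t' j'. discovery \<omega> (t + l) y' = Some t' \<and> 1 \<le> j' \<and> j' \<le> init_particles \<omega> y' \<and>
          particle_position \<omega> y' j' (Suc (t + l) - t') = particle_position \<omega> y j k"
        using y[of "t + l"] assms(2,3) Suc
        by (intro exI[of _ y] exI[of _ t] exI[of _ j]) (simp add: Suc_diff_le)
      with None show ?thesis by simp
    qed simp
    thus ?thesis using Suc by (simp add: discovered_def)
  qed
  thus ?thesis using discovered_mono[of "t + k" "n + k" \<omega>] tn by auto
qed

lemma num_jumps_le: "num_jumps \<omega> x j k \<le> k"
  using card_mono[of "{..<k}" "{i. i < k \<and> clock_tick \<omega> x j i}"]
  by (auto simp: num_jumps_def)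

lemma num_jumps_Suc:
  "num_jumps \<omega> x j (Suc k) = num_jumps \<omega> x j k + (if clock_tick \<omega> x j k then 1 else 0)"
proof -
  have "{i. i < Suc k \<and> clock_tick \<omega> x j i} =
    {i. i < k \<and> clock_tick \<omega> x j i} \<union> (if clock_tick \<omega> x j k then {k} else {})"
    by (auto simp: less_Suc_eq)
  thus ?thesis by (simp add: num_jumps_def)
qed

text \<open>Nothing travels faster than one site per time step. The induction is strong because the
  particle that discovers x may have been activated much earlier, at time s, and has since made at
  most as many jumps as time steps have passed.\<close>

lemma discovered_norm1_le:
  assumes inc: "\<And>y j m. walk_increment \<omega> y j m \<in> unit_steps"
    and "x \<in> discovered \<omega> n"
  shows "norm1 x \<le> n"
  using assms(2)
proof (induction n arbitrary: x rule: less_induct)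
  case (less n)
  from less.prems obtain t where t: "discovery \<omega> n x = Some t" by (auto simp: discovered_def)
  have tn: "t \<le> n" using t by (rule discovery_le)
  show ?case
  proof (cases t)
    case 0
    thus ?thesis using discovery_at_discovery_time[OF t] by (auto split: if_splits)
  next
    case (Suc m)
    have x: "discovery \<omega> (Suc m) x = Some (Suc m)"
      using discovery_at_discovery_time[OF t] Suc by simp
    show ?thesis
    proof (cases "discovery \<omega> m x")
      case (Some s)
      hence "x \<in> discovered \<omega> m" by (auto simp: discovered_def)
      thus ?thesis using less.IH[of m x] tn Suc by simp
    next
      case None
      with x obtain y s j where y: "discovery \<omega> m y = Some s"
        "particle_position \<omega> y j (Suc m - s) = x"
        by (auto split: if_splits)
      have s: "s \<le> m" using y(1) by (rule discovery_le)
      have "y \<in> discovered \<omega> s"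
        using discovery_at_discovery_time[OF y(1)] by (auto simp: discovered_def)
      hence "norm1 y \<le> s" using less.IH[of s y] s tn Suc by simp
      moreover have "norm1 (x - y) \<le> Suc m - s"
      proof -
        have "norm1 (x - y) = norm1 (\<Sum>i<num_jumps \<omega> y j (Suc m - s). walk_increment \<omega> y j i)"
          using y(2) by (auto simp: particle_position_def walk_path_def)
        also have "\<dots> \<le> num_jumps \<omega> y j (Suc m - s)"
          by (rule norm1_sum_unit_steps) (rule inc)
        also have "\<dots> \<le> Suc m - s" by (rule num_jumps_le)
        finally show ?thesis .
      qed
      moreover have "norm1 x \<le> norm1 (x - y) + norm1 y"
        using norm1_triangle[of "x - y" y] by simp
      ultimately show ?thesis using s tn Suc by simp
    qed
  qed
qed

text \<open>Only the first \<open>b ^ m\<close> particles are used, so that this is independent of the initial numbers. A given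
  particle follows the chosen geodesic without pausing with probability at least \<open>q ^ m\<close>, where
  \<open>q = p / (2 d)\<close>; once \<open>b * q \<ge> 2\<close>, all of them fail with probability at most \<open>exp (- (2 ^ m))\<close>.\<close>

definition covering :: "nat \<Rightarrow> 'd::finite sample \<Rightarrow> 'd site \<Rightarrow> nat \<Rightarrow> bool" where
  "covering b \<omega> z m \<longleftrightarrow> (\<forall>x\<in>lattice_ball z m. \<exists>j\<in>{1..b ^ m}. \<forall>i<norm1 (x - z).
     walk_increment \<omega> z j i = geodesic (x - z) i \<and> clock_tick \<omega> z j i)"

lemma covering_discovered:
  assumes "covering b \<omega> z m" "b ^ m \<le> init_particles \<omega> z" "z \<in> discovered \<omega> n"
    and "norm1 (x - z) \<le> m"
  shows "x \<in> discovered \<omega> (n + norm1 (x - z))"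
proof -
  let ?k = "norm1 (x - z)"
  from assms(1,4) obtain j where j: "j \<in> {1..b ^ m}"
    "\<And>i. i < ?k \<Longrightarrow> walk_increment \<omega> z j i = geodesic (x - z) i \<and> clock_tick \<omega> z j i"
    by (auto simp: covering_def lattice_ball_def)
  have "{i. i < ?k \<and> clock_tick \<omega> z j i} = {..<?k}" using j(2) by auto
  hence "num_jumps \<omega> z j ?k = ?k" by (simp add: num_jumps_def)
  hence "particle_position \<omega> z j ?k = z + (\<Sum>i<?k. geodesic (x - z) i)"
    using j(2) by (simp add: particle_position_def walk_path_def)
  also have "\<dots> = x" by (simp add: sum_geodesic)
  finally show ?thesis
    using discovered_step[OF assms(3), of j ?k] j(1) assms(2) by auto
qed

text \<open>The threshold \<open>b ^ (L * r)\<close> is what \<open>covering\<close> uses at scale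
  \<open>L * r\<close>: a rich ball of radius r contains a site able to serve a ball L times as
  large.\<close>

definition rich :: "nat \<Rightarrow> nat \<Rightarrow> ('d::finite site \<Rightarrow> nat) \<Rightarrow> 'd site \<Rightarrow> nat \<Rightarrow> bool" where
  "rich b L \<eta> y r \<longleftrightarrow> (\<exists>z\<in>lattice_ball y r. b ^ (L * r) \<le> \<eta> z)"

text \<open>The centres range over balls of polynomial radius because the first site from which the spread is
  started lies at distance up to \<open>r ^ d\<close> from the origin; the additional factor \<open>r\<close> for the covering
  leaves room for the rich site found near such a centre.\<close>

definition well_behaved :: "nat \<Rightarrow> nat \<Rightarrow> nat \<Rightarrow> 'd::finite sample \<Rightarrow> bool" where
  "well_behaved b L r\<^sub>0 \<omega> \<longleftrightarrow>
     (\<forall>r\<ge>r\<^sub>0. \<forall>z. norm1 z \<le> r ^ (CARD('d) + 1) \<longrightarrow> covering b \<omega> z r) \<and>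
     (\<forall>r\<ge>r\<^sub>0. \<forall>y. norm1 y \<le> r ^ CARD('d) \<longrightarrow> rich b L (init_particles \<omega>) y r)"

text \<open>This is the basic recursion. The rich site z near y is discovered by time n, and from
  there some particle goes straight to x. The detour through z costs at most r, and the hypothesis
  on x keeps the trip within the covering radius \<open>L * r\<close> of z.\<close>

lemma well_behaved_expand:
  fixes y :: "'d::finite site"
  assumes wb: "well_behaved b L r\<^sub>0 \<omega>" and r: "r\<^sub>0 \<le> r" "1 \<le> r" and L: "2 \<le> L"
    and y: "norm1 y \<le> r ^ CARD('d)" and disc: "lattice_ball y r \<subseteq> discovered \<omega> n"
    and x: "norm1 (x - y) + r \<le> L * r"
  shows "x \<in> discovered \<omega> (n + norm1 (x - y) + r)"
proof -
  from wb r y have "rich b L (init_particles \<omega>) y r" by (auto simp: well_behaved_def)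
  then obtain z where z: "z \<in> lattice_ball y r" "b ^ (L * r) \<le> init_particles \<omega> z"
    by (auto simp: rich_def)
  have zy: "norm1 (z - y) \<le> r" using z(1) by (simp add: lattice_ball_def)
  \<comment> \<open>The site z may lie outside the ball of radius \<open>r ^ d\<close>; the exponent
    d + 1 allowed for centres of coverings absorbs the excess, since 2 is at most
    \<open>L * r\<close>.\<close>
  have "norm1 z \<le> norm1 (z - y) + norm1 y" using norm1_triangle[of "z - y" y] by simp
  also have "\<dots> \<le> r + r ^ CARD('d)" using zy y by simp
  also have "\<dots> \<le> 2 * r ^ CARD('d)" using r(2) self_le_power[of r "CARD('d)"] by simp
  also have "\<dots> \<le> (L * r) * (L * r) ^ CARD('d)"
    using mult_le_mono[of 2 L 1 r] mult_le_mono1[of 1 L r] L r(2) by (intro mult_mono power_mono) auto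
  finally have "norm1 z \<le> (L * r) ^ (CARD('d) + 1)" by simp
  moreover have "r\<^sub>0 \<le> L * r" using r L
    by (metis One_nat_def Suc_1 le_trans mult_le_mono1 nat_mult_1 Suc_leD)
  ultimately have cov: "covering b \<omega> z (L * r)" using wb by (auto simp: well_behaved_def)
  have xz: "norm1 (x - z) \<le> norm1 (x - y) + r"
    using norm1_triangle_diff[of x z y] zy by (simp add: norm1_minus_commute[of y z])
  hence "x \<in> discovered \<omega> (n + norm1 (x - z))"
    using z disc x by (intro covering_discovered[OF cov]) auto
  thus ?thesis using discovered_mono[of "n + norm1 (x - z)" "n + norm1 (x - y) + r" \<omega>] xz by auto
qed

text \<open>The covering at y fills the ball of radius r, and every expansion doubles the radius.
  Going from radius s to 2s needs a reach of 2s plus a detour s, hence \<open>3 \<le> L\<close>. The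
  bound on \<open>norm1 y\<close> only gets weaker as the radius grows.\<close>

lemma well_behaved_discovers_everything:
  fixes y :: "'d::finite site"
  assumes wb: "well_behaved b L r\<^sub>0 \<omega>" and r: "r\<^sub>0 \<le> r" "1 \<le> r" and L: "3 \<le> L"
    and y: "norm1 y \<le> r ^ CARD('d)" and ydisc: "y \<in> discovered \<omega> n"
    and rich: "b ^ r \<le> init_particles \<omega> y"
  shows "\<exists>n. x \<in> discovered \<omega> n"
proof -
  have "\<exists>n. lattice_ball y (2 ^ i * r) \<subseteq> discovered \<omega> n" for i
  proof (induction i)
    case 0
    have "r ^ CARD('d) \<le> r ^ (CARD('d) + 1)" using r(2) by (intro power_increasing) auto
    hence "norm1 y \<le> r ^ (CARD('d) + 1)" using y by (rule order_trans[rotated])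
    hence cov: "covering b \<omega> y r" using wb r(1) unfolding well_behaved_def by blast
    have "lattice_ball y r \<subseteq> discovered \<omega> (n + r)"
    proof
      fix x assume "x \<in> lattice_ball y r"
      hence *: "norm1 (x - y) \<le> r" by (simp add: lattice_ball_def)
      show "x \<in> discovered \<omega> (n + r)"
        using covering_discovered[OF cov rich ydisc *] discovered_mono[of "n + norm1 (x - y)" "n + r" \<omega>] *
        by auto
    qed
    thus ?case by auto
  next
    case (Suc i)
    then obtain n where n: "lattice_ball y (2 ^ i * r) \<subseteq> discovered \<omega> n" by blast
    let ?s = "2 ^ i * r"
    have s: "r \<le> ?s" by simp
    have "r ^ CARD('d) \<le> ?s ^ CARD('d)" using s by (intro power_mono) auto
    hence y': "norm1 y \<le> ?s ^ CARD('d)" using y by linarith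
    have "x \<in> discovered \<omega> (n + 3 * ?s)" if x: "x \<in> lattice_ball y (2 ^ Suc i * r)" for x
    proof -
      have xy: "norm1 (x - y) \<le> 2 * ?s" using x by (simp add: lattice_ball_def mult.assoc)
      have "3 * ?s \<le> L * ?s" using L by (rule mult_le_mono1)
      hence "norm1 (x - y) + ?s \<le> L * ?s" "r\<^sub>0 \<le> ?s" "1 \<le> ?s" "2 \<le> L"
        using xy s r L by linarith+
      hence "x \<in> discovered \<omega> (n + norm1 (x - y) + ?s)"
        by (intro well_behaved_expand[OF wb _ _ _ y' n])
      moreover have "n + norm1 (x - y) + ?s \<le> n + 3 * ?s" using xy by linarith
      ultimately show ?thesis using discovered_mono by blast
    qed
    thus ?case by (intro exI[of _ "n + 3 * ?s"] subsetI)
  qed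
  \<comment> \<open>Any number of doublings that is large enough will do; as k is at most 2 ^ k, the
    distance itself is one.\<close>
  moreover have "x \<in> lattice_ball y (2 ^ norm1 (x - y) * r)"
  proof -
    have "norm1 (x - y) \<le> 2 ^ norm1 (x - y)" by (simp add: less_imp_le)
    also have "\<dots> \<le> 2 ^ norm1 (x - y) * r" using r(2) by simp
    finally show ?thesis by (simp add: lattice_ball_def)
  qed
  ultimately show ?thesis by blast
qed

text \<open>Strong induction with r about m / 2: the recursion gives (c + 4r) + m + r, which is at
  most c + 4m once 5r is at most 3m. The start is a finite ball, whose discovery times have a
  maximum c.\<close>

lemma well_behaved_linear_speed:
  fixes \<omega> :: "'d::finite sample"
  assumes wb: "well_behaved b L r\<^sub>0 \<omega>" and L: "3 \<le> L"
    and all: "\<And>x. \<exists>n. x \<in> discovered \<omega> n"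
  shows "\<exists>c. \<forall>m. lattice_ball 0 m \<subseteq> discovered \<omega> (c + 4 * m)"
proof -
  \<comment> \<open>For m above 2R, the half r of m, rounded up, is at least
    \<open>r\<^sub>0\<close>, and m exceeds 20, more than the 5 needed for 5r to stay below 3m
    despite the rounding.\<close>
  define R where "R = max r\<^sub>0 10"
  have "\<exists>n. lattice_ball 0 (2 * R) \<subseteq> discovered \<omega> n"
  proof -
    from all obtain f where f: "\<And>x. x \<in> discovered \<omega> (f x)" by metis
    have "lattice_ball 0 (2 * R) \<subseteq> discovered \<omega> (Max (f ` lattice_ball 0 (2 * R)))"
    proof
      fix x assume "x \<in> lattice_ball (0::'d site) (2 * R)"
      hence "f x \<le> Max (f ` lattice_ball 0 (2 * R))" by (intro Max_ge) auto
      thus "x \<in> discovered \<omega> (Max (f ` lattice_ball 0 (2 * R)))" using f[of x] discovered_mono by blast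
    qed
    thus ?thesis ..
  qed
  then obtain c where c: "lattice_ball 0 (2 * R) \<subseteq> discovered \<omega> c" ..
  have "lattice_ball 0 m \<subseteq> discovered \<omega> (c + 4 * m)" for m
  proof (induction m rule: less_induct)
    case (less m)
    show ?case
    proof (cases "m \<le> 2 * R")
      case True
      have "lattice_ball 0 m \<subseteq> lattice_ball (0::'d site) (2 * R)" using True by (auto simp: lattice_ball_def)
      thus ?thesis using c discovered_mono[of c "c + 4 * m" \<omega>] by auto
    next
      case False
      define r where "r = (m + 1) div 2"
      have r: "r\<^sub>0 \<le> r" "1 \<le> r" "r < m" "m \<le> 2 * r" "5 * r \<le> 3 * m"
        using False by (auto simp: r_def R_def)
      have "x \<in> discovered \<omega> (c + 4 * m)" if "x \<in> lattice_ball 0 m" for x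
      proof -
        have x: "norm1 x \<le> m" using that by (simp add: lattice_ball_def)
        have "3 * r \<le> L * r" using L by (rule mult_le_mono1)
        hence "norm1 x + r \<le> L * r" using x r(4) by linarith
        hence "x \<in> discovered \<omega> (c + 4 * r + norm1 (x - 0) + r)"
          using r L by (intro well_behaved_expand[OF wb _ _ _ _ less.IH]) auto
        thus ?thesis using discovered_mono[of "c + 4 * r + norm1 (x - 0) + r" "c + 4 * m" \<omega>] r x by auto
      qed
      thus ?thesis by blast
    qed
  qed
  thus ?thesis by blast
qed

text \<open>A single expansion now suffices, started from a ball of radius r about m / l. Filling
  that ball takes c + 4r by the crude linear bound, and the expansion adds m + r. The total overhead
  5r is a small fraction of m when l is large.\<close>

lemma well_behaved_unit_speed:
  fixes \<omega> :: "'d::finite sample"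
  assumes wb: "well_behaved b (l + 1) r\<^sub>0 \<omega>" and l: "2 \<le> l"
    and all: "\<And>x. \<exists>n. x \<in> discovered \<omega> n"
  shows "\<exists>c. \<forall>m. lattice_ball 0 m \<subseteq> discovered \<omega> (c + m + 5 * (m div l))"
proof -
  from well_behaved_linear_speed[OF wb _ all] l obtain c where
    c: "\<And>m. lattice_ball 0 m \<subseteq> discovered \<omega> (c + 4 * m)" by auto
  have "x \<in> discovered \<omega> (c + 5 * (r\<^sub>0 + 1) + m + 5 * (m div l))" if "x \<in> lattice_ball 0 m" for m x
  proof -
    \<comment> \<open>The summand 1 makes up for the rounded division, so that m is at most
      \<open>l * ?r\<close>; the summand \<open>r\<^sub>0\<close> makes the scale admissible for
      every m. Both enter only the additive constant.\<close>
    let ?r = "m div l + r\<^sub>0 + 1"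
    have x: "norm1 x \<le> m" using that by (simp add: lattice_ball_def)
    have "m \<le> l * ?r" 
    proof -
      have "m = l * (m div l) + m mod l" by simp
      moreover have "m mod l < l" using l by simp
      ultimately have "m \<le> l * (m div l) + l" by linarith
      thus ?thesis by (simp add: algebra_simps)
    qed
    hence "x \<in> discovered \<omega> (c + 4 * ?r + norm1 (x - 0) + ?r)"
      using x l by (intro well_behaved_expand[OF wb _ _ _ _ c]) auto
    thus ?thesis
      using discovered_mono[of "c + 4 * ?r + norm1 (x - 0) + ?r" "c + 5 * (r\<^sub>0 + 1) + m + 5 * (m div l)" \<omega>] x
      by (auto simp: algebra_simps)
  qed
  thus ?thesis by (intro exI[of _ "c + 5 * (r\<^sub>0 + 1)"]) blast
qed


section \<open>Product measures\<close>

text \<open>Disjoint groups of independent events generate independent sigma-algebras, and the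
  complement of a block's intersection lies in the one generated by that block. Intersecting with
  \<open>space M\<close> gives the right meaning to empty blocks and empty \<open>J\<close>, where
  the intersection would be \<open>UNIV\<close>.\<close>

lemma (in prob_space) prob_no_block_occurs:
  assumes indep: "indep_sets (\<lambda>i. {A i}) UNIV"
    and fin: "finite J" "\<And>j. j \<in> J \<Longrightarrow> finite (I j)"
    and disj: "disjoint_family_on I J"
  shows "prob (space M \<inter> (\<Inter>j\<in>J. space M - (space M \<inter> (\<Inter>i\<in>I j. A i)))) = (\<Prod>j\<in>J. 1 - (\<Prod>i\<in>I j. prob (A i)))"
proof (cases "J = {}")
  case True
  thus ?thesis by (simp add: prob_space)
next
  case False
  have ev: "A i \<in> events" for i using indep by (auto simp: indep_sets_def)
  have indep': "indep_sets (\<lambda>j. sigma_sets (space M) (\<Union>i\<in>I j. {A i})) J"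
    by (rule indep_sets_collect_sigma)
      (use disj in \<open>auto intro: indep_sets_mono_index[OF _ indep] simp: Int_stable_def\<close>)
  let ?B = "\<lambda>j. space M \<inter> (\<Inter>i\<in>I j. A i)"
  have sig: "space M - ?B j \<in> sigma_sets (space M) (\<Union>i\<in>I j. {A i})" if "j \<in> J" for j
  proof -
    interpret S: sigma_algebra "space M" "sigma_sets (space M) (\<Union>i\<in>I j. {A i})"
      using sets.sets_into_space[OF ev] by (intro sigma_algebra_sigma_sets) auto
    have "?B j \<in> sigma_sets (space M) (\<Union>i\<in>I j. {A i})"
    proof (cases "I j = {}")
      case True
      thus ?thesis using S.top by simp
    next
      case False
      hence "(\<Inter>i\<in>I j. A i) \<in> sigma_sets (space M) (\<Union>i\<in>I j. {A i})"
        using fin(2)[OF that] by (intro S.finite_INT) auto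
      thus ?thesis by blast
    qed
    thus ?thesis by (rule S.compl_sets)
  qed
  have B: "prob (?B j) = (\<Prod>i\<in>I j. prob (A i))" if "j \<in> J" for j
  proof (cases "I j = {}")
    case True
    thus ?thesis by (simp add: prob_space)
  next
    case False
    hence "?B j = (\<Inter>i\<in>I j. A i)" using sets.sets_into_space[OF ev] by blast
    thus ?thesis using indep_setsD[OF indep, of "I j" A] False fin(2)[OF that] by auto
  qed
  have Bev: "?B j \<in> events" if "j \<in> J" for j
    using ev fin(2)[OF that] by (cases "I j = {}") (auto intro!: sets.Int sets.finite_INT)
  have "space M \<inter> (\<Inter>j\<in>J. space M - ?B j) = (\<Inter>j\<in>J. space M - ?B j)"
    using False by blast
  also have "prob \<dots> = (\<Prod>j\<in>J. prob (space M - ?B j))"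
    using sig False fin(1) by (intro indep_setsD[OF indep']) auto
  also have "\<dots> = (\<Prod>j\<in>J. 1 - (\<Prod>i\<in>I j. prob (A i)))"
    by (intro prod.cong refl) (simp add: prob_compl Bev B)
  finally show ?thesis .
qed

section \<open>The probability space of the particle motions\<close>

abbreviation walks_measure :: "('d::finite site \<times> nat \<times> nat \<Rightarrow> 'd site) measure" where
  "walks_measure \<equiv> \<Pi>\<^sub>M i\<in>UNIV. measure_pmf (pmf_of_set unit_steps)"

abbreviation clocks_measure :: "real \<Rightarrow> ('d::finite site \<times> nat \<times> nat \<Rightarrow> bool) measure" where
  "clocks_measure p \<equiv> \<Pi>\<^sub>M i\<in>UNIV. measure_pmf (bernoulli_pmf p)"

abbreviation motion_measure ::
    "real \<Rightarrow> (('d::finite site \<times> nat \<times> nat \<Rightarrow> 'd site) \<times> ('d site \<times> nat \<times> nat \<Rightarrow> bool)) measure" where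
  "motion_measure p \<equiv> walks_measure \<Otimes>\<^sub>M clocks_measure p"

lemma unit_steps_eq_image: "unit_steps = (\<lambda>(i, s). axis i s) ` (UNIV \<times> {1, - 1})"
  unfolding unit_steps_def by auto

lemma finite_unit_steps [simp]: "finite unit_steps"
  unfolding unit_steps_eq_image by (intro finite_imageI finite_cartesian_product) auto

lemma unit_steps_nonempty [simp]: "unit_steps \<noteq> {}"
  by (auto simp: unit_steps_def)

lemma product_prob_space_pmf: "product_prob_space (\<lambda>_. measure_pmf \<mu>)"
  by unfold_locales

lemma prob_space_PiM_pmf: "prob_space (\<Pi>\<^sub>M i\<in>I. measure_pmf \<mu>)"
  by (intro prob_space_PiM prob_space_measure_pmf)

lemma prob_space_motion: "prob_space (motion_measure p)"
  by (intro prob_space_pair prob_space_PiM_pmf)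

lemma prob_space_initial: "prob_space (initial_measure \<mu>)"
  unfolding initial_measure_def by (rule prob_space_PiM_pmf)

lemma measure_PiM_pmf_Collect:
  assumes "finite J"
  shows "measure (\<Pi>\<^sub>M i\<in>UNIV. measure_pmf \<mu>) {f. \<forall>i\<in>J. f i \<in> X i} = (\<Prod>i\<in>J. measure_pmf.prob \<mu> (X i))"
proof -
  interpret product_prob_space "\<lambda>_. measure_pmf \<mu>" UNIV by (rule product_prob_space_pmf)
  have "{f. \<forall>i\<in>J. f i \<in> X i} = prod_emb UNIV (\<lambda>_. measure_pmf \<mu>) J (Pi\<^sub>E J X)"
    by (auto simp: prod_emb_def)
  thus ?thesis using measure_PiM_emb[of J X] assms by simp
qed

lemma sets_PiM_pmf_Collect:
  assumes "finite J"
  shows "{f. \<forall>i\<in>J. f i \<in> X i} \<in> sets (\<Pi>\<^sub>M i\<in>UNIV. measure_pmf \<mu>)"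
proof -
  have "{f. \<forall>i\<in>J. f i \<in> X i} = prod_emb UNIV (\<lambda>_. measure_pmf \<mu>) J (Pi\<^sub>E J X)"
    by (auto simp: prod_emb_def)
  also have "\<dots> \<in> sets (\<Pi>\<^sub>M i\<in>UNIV. measure_pmf \<mu>)"
    using assms by (intro sets_PiM_I) auto
  finally show ?thesis .
qed

text \<open>Increments are numbered by jumps and ticks by time. The two numberings agree while a
  particle has not paused, so on the intersection over an initial segment of indices the particle
  really travels along \<open>u\<close>.\<close>

definition moves_along ::
    "('d::finite site \<times> nat \<times> nat \<Rightarrow> 'd site) \<Rightarrow> 'd site \<times> nat \<times> nat \<Rightarrow>
     (('d site \<times> nat \<times> nat \<Rightarrow> 'd site) \<times> ('d site \<times> nat \<times> nat \<Rightarrow> bool)) set" where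
  "moves_along u i = {(w, c). w i = u i \<and> c i}"

text \<open>The q = p / (2 d) from above. The number of unit steps is never evaluated; it only
  matters that it is at least 1.\<close>

definition move_prob :: "real \<Rightarrow> 'd::finite itself \<Rightarrow> real" where
  "move_prob p d = p / card (unit_steps :: 'd site set)"

lemma moves_along_Inter:
  assumes "finite J" "0 \<le> p" "p \<le> 1" "\<And>i. u i \<in> unit_steps"
  shows "measure (motion_measure p) (\<Inter>i\<in>J. moves_along u i) = move_prob p TYPE('d::finite) ^ card J"
    and "(\<Inter>i\<in>J. moves_along u i) \<in> sets (motion_measure p :: (('d site \<times> nat \<times> nat \<Rightarrow> 'd site) \<times> _) measure)"
proof -
  interpret W: prob_space "walks_measure :: ('d site \<times> nat \<times> nat \<Rightarrow> 'd site) measure"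
    by (rule prob_space_PiM_pmf)
  interpret C: prob_space "clocks_measure p :: ('d site \<times> nat \<times> nat \<Rightarrow> bool) measure"
    by (rule prob_space_PiM_pmf)
  have eq: "(\<Inter>i\<in>J. moves_along u i) = {w. \<forall>i\<in>J. w i \<in> {u i}} \<times> {c. \<forall>i\<in>J. c i \<in> {True}}"
    by (auto simp: moves_along_def)
  have m: "{w. \<forall>i\<in>J. w i \<in> {u i}} \<in> sets walks_measure" "{c. \<forall>i\<in>J. c i \<in> {True}} \<in> sets (clocks_measure p)"
    by (rule sets_PiM_pmf_Collect[OF assms(1)])+
  show "(\<Inter>i\<in>J. moves_along u i) \<in> sets (motion_measure p)"
    unfolding eq using m by (rule pair_measureI)
  have "measure (motion_measure p) (\<Inter>i\<in>J. moves_along u i) =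
      measure walks_measure {w. \<forall>i\<in>J. w i \<in> {u i}} * measure (clocks_measure p) {c. \<forall>i\<in>J. c i \<in> {True}}"
    unfolding eq measure_def
    using m by (simp add: C.emeasure_pair_measure_Times enn2real_mult)
  also have "\<dots> = (\<Prod>i\<in>J. 1 / card (unit_steps :: 'd site set)) * (\<Prod>i\<in>J. p)"
    using assms by (simp only: measure_PiM_pmf_Collect) (simp add: measure_pmf_single)
  also have "\<dots> = move_prob p TYPE('d) ^ card J"
    by (simp add: move_prob_def power_divide)
  finally show "measure (motion_measure p) (\<Inter>i\<in>J. moves_along u i) = move_prob p TYPE('d) ^ card J" .
qed

text \<open>It serves twice: with one block per particle of a site, for the coverings, and with
  successive time windows of a single particle, for its straight runs.\<close>

lemma prob_no_block_moves:
  fixes u :: "'d::finite site \<times> nat \<times> nat \<Rightarrow> 'd site"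
  assumes p: "0 \<le> p" "p \<le> 1" and u: "\<And>i. u i \<in> unit_steps"
    and J: "finite J" "\<And>j. j \<in> J \<Longrightarrow> finite (I j)" "\<And>j. j \<in> J \<Longrightarrow> card (I j) = k" "disjoint_family_on I J"
  shows "measure (motion_measure p) (\<Inter>j\<in>J. - (\<Inter>i\<in>I j. moves_along u i)) = (1 - move_prob p TYPE('d) ^ k) ^ card J"
    (is ?A)
    and "(\<Inter>j\<in>J. - (\<Inter>i\<in>I j. moves_along u i)) \<in> sets (motion_measure p)" (is ?B)
proof -
  interpret M: prob_space "motion_measure p :: (('d site \<times> nat \<times> nat \<Rightarrow> 'd site) \<times> _) measure"
    by (rule prob_space_motion)
  have sp: "space (motion_measure p :: (('d site \<times> nat \<times> nat \<Rightarrow> 'd site) \<times> _) measure) = UNIV"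
    by (simp add: space_pair_measure space_PiM)
  note P = moves_along_Inter[OF _ p u]
  have single: "measure (motion_measure p) (moves_along u i) = move_prob p TYPE('d)" for i
    using P(1)[of "{i}"] by simp
  have "M.indep_sets (\<lambda>i. {moves_along u i}) UNIV"
  proof (rule M.indep_setsI)
    show "{moves_along u i} \<subseteq> M.events" for i using P(2)[of "{i}"] by simp
    fix A J assume J: "J \<noteq> {}" "J \<subseteq> UNIV" "finite J" and A: "\<forall>j\<in>J. A j \<in> {moves_along u j}"
    have "M.prob (\<Inter>j\<in>J. A j) = M.prob (\<Inter>j\<in>J. moves_along u j)" using A by simp
    also have "\<dots> = (\<Prod>j\<in>J. M.prob (A j))" using A P(1)[OF J(3)] single by simp
    finally show "M.prob (\<Inter>j\<in>J. A j) = (\<Prod>j\<in>J. M.prob (A j))" .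
  qed
  from M.prob_no_block_occurs[OF this J(1,2,4)] J(3) show ?A
    by (simp add: sp single Compl_eq_Diff_UNIV)
  have "UNIV - (\<Inter>i\<in>I j. moves_along u i) \<in> M.events" if "j \<in> J" for j
    using sets.compl_sets[OF P(2)[OF J(2)[OF that]]] by (simp add: sp)
  moreover have "UNIV \<in> M.events" using sets.top[of "motion_measure p :: (('d site \<times> nat \<times> nat \<Rightarrow> 'd site) \<times> _) measure"] by (simp add: sp)
  ultimately show ?B using J(1) unfolding Compl_eq_Diff_UNIV
    by (cases "J = {}") (auto simp del: INT_simps intro!: sets.finite_INT)
qed

section \<open>Summability and almost sure statements on products\<close>

lemma summable_powr_exp:
  fixes c g e :: real
  assumes "0 < c" "0 < g"
  shows "summable (\<lambda>n. real n powr e * exp (- c * real n powr g))"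
proof (rule summable_comparison_test_bigo)
  show "summable (\<lambda>n. norm (real n powr - 2))"
    using summable_real_powr_iff[of "-2"] by simp
  show "(\<lambda>n. real n powr e * exp (- c * real n powr g)) \<in> O(\<lambda>n. real n powr - 2)"
    using assms by real_asymp
qed

lemma AE_snd_pair:
  assumes "prob_space M" "prob_space N" "AE y in N. P y"
  shows "AE \<omega> in M \<Otimes>\<^sub>M N. P (snd \<omega>)"
proof -
  interpret N: prob_space N by fact
  from assms(3) obtain A where A: "{y \<in> space N. \<not> P y} \<subseteq> A" "emeasure N A = 0" "A \<in> sets N"
    by (rule AE_E)
  have "emeasure (M \<Otimes>\<^sub>M N) (space M \<times> A) = 0"
    using A by (simp add: N.emeasure_pair_measure_Times)
  moreover have "{\<omega> \<in> space (M \<Otimes>\<^sub>M N). \<not> P (snd \<omega>)} \<subseteq> space M \<times> A"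
    using A(1) by (auto simp: space_pair_measure)
  ultimately show ?thesis using A(3) by (intro AE_I) auto
qed

lemma AE_fst_pair:
  assumes "prob_space N" "AE x in M. P x"
  shows "AE \<omega> in M \<Otimes>\<^sub>M N. P (fst \<omega>)"
proof (rule AE_distrD[OF measurable_fst])
  show "AE x in distr (M \<Otimes>\<^sub>M N) M fst. P x"
    unfolding prob_space.distr_pair_fst[OF assms(1)] by (rule assms(2))
qed


section \<open>Covering and rich balls\<close>

lemma moves_along_block:
  "(\<eta>, wc) = \<omega> \<Longrightarrow> wc \<in> moves_along u (z, j, i) \<longleftrightarrow> walk_increment \<omega> z j i = u (z, j, i) \<and> clock_tick \<omega> z j i"
  by (cases wc) (auto simp: moves_along_def walk_increment_def clock_tick_def)

lemma move_prob_bounds: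
  assumes "0 < p" "p \<le> 1"
  shows "0 < move_prob p TYPE('d::finite)" "move_prob p TYPE('d) \<le> 1"
proof -
  have c: "1 \<le> card (unit_steps :: 'd site set)"
    using card_gt_0_iff[of "unit_steps :: 'd site set"] by simp
  thus "0 < move_prob p TYPE('d)" using assms by (simp add: move_prob_def)
  have "p \<le> real (card (unit_steps :: 'd site set))" using c assms by linarith
  thus "move_prob p TYPE('d) \<le> 1" using c by (simp add: move_prob_def field_simps)
qed

text \<open>A union bound over the targets x. The bad set B lives in the motion space alone and
  works for every \<eta> at once, because \<open>covering\<close> consults the first
  \<open>b ^ m\<close> particles whatever their actual number. Bounding by a measurable superset
  avoids measurability of \<open>covering\<close>.\<close>

lemma prob_not_covering:
  assumes p: "0 < p" "p \<le> 1" and b: "2 \<le> real b * move_prob p TYPE('d)"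
  shows "\<exists>B\<in>sets (motion_measure p). measure (motion_measure p) B \<le> (2 * real m + 1) ^ CARD('d) * exp (- (2 ^ m)) \<and>
    (\<forall>\<eta> wc. wc \<notin> B \<longrightarrow> covering b (\<eta>, wc) (z :: 'd::finite site) m)"
proof -
  interpret M: prob_space "motion_measure p :: (('d site \<times> nat \<times> nat \<Rightarrow> 'd site) \<times> _) measure"
    by (rule prob_space_motion)
  let ?q = "move_prob p TYPE('d)"
  note q = move_prob_bounds[OF p, where 'd='d]
  \<comment> \<open>The block of particle j consists of its first \<open>norm1 (x - z)\<close>
    indices; different particles have disjoint blocks.\<close>
  define I :: "'d site \<Rightarrow> nat \<Rightarrow> ('d site \<times> nat \<times> nat) set" where
    "I = (\<lambda>x j. (\<lambda>i. (z, j, i)) ` {..<norm1 (x - z)})"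
  define u :: "'d site \<Rightarrow> 'd site \<times> nat \<times> nat \<Rightarrow> 'd site" where "u = (\<lambda>x (z, j, i). geodesic (x - z) i)"
  define B where "B = (\<lambda>x. \<Inter>j\<in>{1..b ^ m}. - (\<Inter>i\<in>I x j. moves_along (u x) i))"
  have card_I: "card (I x j) = norm1 (x - z)" for x j
    unfolding I_def by (subst card_image) (auto simp: inj_on_def)
  have disj: "disjoint_family_on (I x) J" for x J
    by (auto simp: disjoint_family_on_def I_def)
  have u: "u x i \<in> unit_steps" for x i by (auto simp: u_def geodesic_unit_steps split: prod.split)
  have B_sets: "B x \<in> sets (motion_measure p)" for x
    unfolding B_def using p by (intro prob_no_block_moves(2)[where k = "norm1 (x - z)"] u disj card_I) (auto simp: I_def)
  have B_prob: "M.prob (B x) \<le> exp (- (2 ^ m))" if x: "x \<in> lattice_ball z m" for x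
  proof -
    have xm: "norm1 (x - z) \<le> m" using x by (simp add: lattice_ball_def)
    have "M.prob (B x) = (1 - ?q ^ norm1 (x - z)) ^ card {1..b ^ m}"
      unfolding B_def using p by (intro prob_no_block_moves(1) u disj card_I) (auto simp: I_def)
    \<comment> \<open>Nearer targets are easier, so the worst distance m bounds all of them.\<close>
    also have "\<dots> \<le> (1 - ?q ^ m) ^ (b ^ m)"
      using q xm by (auto intro!: power_mono power_decreasing simp: power_le_one)
    also have "\<dots> \<le> exp (- (?q ^ m)) ^ (b ^ m)"
      using q exp_ge_add_one_self[of "- (?q ^ m)"] by (intro power_mono) (auto simp: power_le_one)
    also have "\<dots> = exp (- ((real b * ?q) ^ m))"
      by (simp add: exp_of_nat_mult[symmetric] power_mult_distrib)
    also have "\<dots> \<le> exp (- (2 ^ m))" using b power_mono[of 2 "real b * ?q" m] by simp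
    finally show ?thesis .
  qed
  let ?B = "\<Union>x\<in>lattice_ball z m. B x"
  have "M.prob ?B \<le> (\<Sum>x\<in>lattice_ball z m. M.prob (B x))"
    using B_sets by (intro M.finite_measure_subadditive_finite) auto
  also have "\<dots> \<le> card (lattice_ball z m) * exp (- (2 ^ m))"
    using sum_bounded_above[of "lattice_ball z m" "\<lambda>x. M.prob (B x)", OF B_prob] by simp
  also have "\<dots> \<le> (2 * real m + 1) ^ CARD('d) * exp (- (2 ^ m))"
    by (intro mult_right_mono real_card_lattice_ball_le) auto
  finally have "M.prob ?B \<le> (2 * real m + 1) ^ CARD('d) * exp (- (2 ^ m))" .
  moreover have "?B \<in> sets (motion_measure p)" using B_sets by (intro sets.finite_UN) auto
  moreover have "covering b (\<eta>, wc) z m" if "wc \<notin> ?B" for \<eta> wc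
    unfolding covering_def
  proof
    fix x assume x: "x \<in> lattice_ball z m"
    with that have "wc \<notin> B x" by blast
    then obtain j where j: "j \<in> {1..b ^ m}" "\<And>i. i \<in> I x j \<Longrightarrow> wc \<in> moves_along (u x) i"
      unfolding B_def by blast
    have "walk_increment (\<eta>, wc) z j i = geodesic (x - z) i \<and> clock_tick (\<eta>, wc) z j i"
      if "i < norm1 (x - z)" for i
      using j(2)[of "(z, j, i)"] that moves_along_block[OF refl, of wc "u x" z j i] by (auto simp: I_def u_def)
    with j(1) show "\<exists>j\<in>{1..b ^ m}. \<forall>i<norm1 (x - z).
      walk_increment (\<eta>, wc) z j i = geodesic (x - z) i \<and> clock_tick (\<eta>, wc) z j i" by blast
  qed
  ultimately show ?thesis by blast
qed

text \<open>Borel-Cantelli in the shape needed below: the power of n comes from a union bound over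
  polynomially many centres, and the stretched exponential beats it.\<close>

lemma (in prob_space) AE_eventually_stretched_exp:
  fixes c g e a :: real
  assumes cg: "0 < c" "0 < g"
    and B: "\<And>n. B n \<in> events" "\<forall>\<^sub>F n in sequentially. prob (B n) \<le> a * (real n powr e * exp (- c * real n powr g))"
  shows "AE \<omega> in M. \<forall>\<^sub>F n in sequentially. \<omega> \<notin> B n"
proof -
  have "summable (\<lambda>n. prob (B n))"
    using B(2) by (intro summable_comparison_test_ev[OF _ summable_mult[OF summable_powr_exp[OF cg]]]) simp
  hence "AE \<omega> in M. \<forall>\<^sub>F n in sequentially. \<omega> \<in> space M - B n"
    using B(1) by (intro borel_cantelli_AE1) (auto simp: emeasure_eq_measure)
  thus ?thesis by eventually_elim (auto elim: eventually_mono)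
qed

lemma AE_eventually_covering:
  assumes p: "0 < p" "p \<le> 1" and b: "2 \<le> real b * move_prob p TYPE('d::finite)"
  shows "AE \<omega> in frog_measure \<mu> p. \<forall>\<^sub>F m in sequentially.
    \<forall>z :: 'd site. norm1 z \<le> m ^ (CARD('d) + 1) \<longrightarrow> covering b \<omega> z m"
proof -
  interpret M: prob_space "motion_measure p :: (('d site \<times> nat \<times> nat \<Rightarrow> 'd site) \<times> _) measure"
    by (rule prob_space_motion)
  let ?d = "CARD('d)"
  have "\<forall>z m. \<exists>B. B \<in> M.events \<and> M.prob B \<le> (2 * real m + 1) ^ ?d * exp (- (2 ^ m)) \<and>
    (\<forall>\<eta> wc. wc \<notin> B \<longrightarrow> covering b (\<eta>, wc) (z :: 'd site) m)"
    using prob_not_covering[OF p b] by blast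
  then obtain B where B: "\<And>z m. B z m \<in> M.events"
    "\<And>z m. M.prob (B z m) \<le> (2 * real m + 1) ^ ?d * exp (- (2 ^ m))"
    "\<And>z m \<eta> wc. wc \<notin> B z m \<Longrightarrow> covering b (\<eta>, wc) (z :: 'd site) m" by metis
  let ?N = "\<lambda>m. m ^ (?d + 1)"
  define C where "C = (\<lambda>m. \<Union>z\<in>lattice_ball 0 (?N m). B z m)"
  have C: "M.prob (C m) \<le> 9 ^ ?d * (real m powr (?d * (?d + 2)) * exp (- 1 * real m powr 1))" if m: "1 \<le> m" for m
  proof -
    have "M.prob (C m) \<le> (\<Sum>z\<in>lattice_ball 0 (?N m). M.prob (B z m))"
      unfolding C_def using B(1) by (intro M.finite_measure_subadditive_finite) auto
    also have "\<dots> \<le> card (lattice_ball (0 :: 'd site) (?N m)) * ((2 * real m + 1) ^ ?d * exp (- (2 ^ m)))"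
      using sum_bounded_above[of "lattice_ball 0 (?N m)" "\<lambda>z. M.prob (B z m)", OF B(2)] by simp
    \<comment> \<open>Of the doubly exponential decay only exp (-m) is kept. The additive ones are
      absorbed by replacing 2 with 3, and the exponents d (d + 1) and d add up to d (d + 2).\<close>
    also have "\<dots> \<le> (3 * real m ^ (?d + 1)) ^ ?d * ((3 * real m) ^ ?d * exp (- real m))"
    proof (intro mult_mono)
      have "real (card (lattice_ball (0 :: 'd site) (?N m))) \<le> (2 * real m ^ (?d + 1) + 1) ^ ?d"
        using real_card_lattice_ball_le[of "0 :: 'd site" "?N m"] by simp
      also have "\<dots> \<le> (3 * real m ^ (?d + 1)) ^ ?d"
        using m one_le_power[of "real m" "?d + 1"] by (intro power_mono) auto
      finally show "real (card (lattice_ball (0 :: 'd site) (?N m))) \<le> (3 * real m ^ (?d + 1)) ^ ?d" .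
      show "(2 * real m + 1) ^ ?d \<le> (3 * real m) ^ ?d"
        using m by (intro power_mono) auto
      have "m < 2 ^ m" by simp
      hence "real m \<le> 2 ^ m" by (metis less_imp_le of_nat_le_iff of_nat_numeral of_nat_power)
      thus "exp (- (2 ^ m)) \<le> exp (- real m)" by simp
    qed auto
    also have "\<dots> = 9 ^ ?d * (real m ^ (?d * (?d + 2)) * exp (- real m))"
    proof -
      have "(3 * real m ^ (?d + 1)) ^ ?d * (3 * real m) ^ ?d = (9 * (real m ^ (?d + 1) * real m)) ^ ?d"
        by (subst power_mult_distrib[symmetric]) (simp add: algebra_simps)
      also have "real m ^ (?d + 1) * real m = real m ^ (?d + 2)" by simp
      also have "(9 * real m ^ (?d + 2)) ^ ?d = 9 ^ ?d * real m ^ (?d * (?d + 2))"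
        by (simp only: power_mult_distrib power_mult[symmetric] mult.commute[of "?d + 2"])
      finally show ?thesis by (simp only: mult.assoc[symmetric])
    qed
    also have "real m ^ (?d * (?d + 2)) = real m powr real (?d * (?d + 2))"
      using m by (intro powr_realpow[symmetric]) auto
    finally show ?thesis by simp
  qed
  have "AE wc in motion_measure p. \<forall>\<^sub>F m in sequentially. wc \<notin> C m"
  proof (rule M.AE_eventually_stretched_exp)
    show "C m \<in> M.events" for m unfolding C_def using B(1) by (intro sets.finite_UN) auto
    show "\<forall>\<^sub>F m in sequentially. M.prob (C m) \<le> 9 ^ ?d * (real m powr real (?d * (?d + 2)) * exp (- 1 * real m powr 1))"
      using eventually_ge_at_top[of 1] by eventually_elim (use C in auto)
  qed auto
  hence "AE \<omega> in frog_measure \<mu> p. \<forall>\<^sub>F m in sequentially. snd \<omega> \<notin> C m"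
    unfolding frog_measure_def by (intro AE_snd_pair prob_space_initial prob_space_motion)
  thus ?thesis
  proof eventually_elim
    case (elim \<omega>)
    thus ?case
    proof eventually_elim
      case (elim m)
      have "covering b (fst \<omega>, snd \<omega>) z m" if "norm1 z \<le> m ^ (CARD('d) + 1)" for z
        using elim that by (intro B(3)) (auto simp: C_def lattice_ball_def)
      thus ?case by simp
    qed
  qed
qed

section \<open>Abundance of rich sites\<close>

lemma prob_all_below:
  assumes "finite S"
  shows "measure (initial_measure \<mu>) {\<eta>. \<forall>z\<in>S. \<eta> z < n} = (1 - measure_pmf.prob \<mu> {k. k \<ge> n}) ^ card S"
    and "{\<eta>. \<forall>z\<in>S. \<eta> z < n} \<in> sets (initial_measure \<mu>)"
proof -
  have "measure (initial_measure \<mu>) {\<eta>. \<forall>z\<in>S. \<eta> z \<in> {..<n}} = measure_pmf.prob \<mu> {..<n} ^ card S"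
    unfolding initial_measure_def using assms by (simp only: measure_PiM_pmf_Collect) simp
  moreover have "{..<n} = UNIV - {k. k \<ge> n}" by auto
  hence "measure_pmf.prob \<mu> {..<n} = 1 - measure_pmf.prob \<mu> {k. k \<ge> n}"
    using measure_pmf.prob_compl[of "{k. k \<ge> n}" \<mu>] by simp
  ultimately show "measure (initial_measure \<mu>) {\<eta>. \<forall>z\<in>S. \<eta> z < n} = (1 - measure_pmf.prob \<mu> {k. k \<ge> n}) ^ card S"
    by simp
  show "{\<eta>. \<forall>z\<in>S. \<eta> z < n} \<in> sets (initial_measure \<mu>)"
    using sets_PiM_pmf_Collect[OF assms, of "\<lambda>_. {..<n}" \<mu>] by (simp add: initial_measure_def)
qed

text \<open>The logarithm turns the exponential threshold into a linear quantity, so a site is rich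
  with probability at least of order r to the power -\<delta>. Among order r ^ d independent sites
  all fail with probability exp (- c r ^ (d - \<delta>)). The set \<open>S\<close> is arbitrary
  because it is applied both to balls and to the sites visited by a walk.\<close>

lemma prob_all_below_stretched_exp:
  fixes \<delta> :: real
  assumes tail: "\<forall>\<^sub>F n in sequentially. measure_pmf.prob \<mu> {k. k \<ge> n} \<ge> ln (real n) powr (- \<delta>)"
    and b: "2 \<le> b" and L: "1 \<le> L"
  obtains c where "0 < c"
    "\<forall>\<^sub>F r in sequentially. \<forall>S :: 'd::finite site set. finite S \<longrightarrow> (real r / CARD('d)) ^ CARD('d) \<le> card S \<longrightarrow>
       measure (initial_measure \<mu>) {\<eta>. \<forall>z\<in>S. \<eta> z < b ^ (L * r)} \<le> exp (- c * real r powr (CARD('d) - \<delta>))"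
proof
  let ?d = "CARD('d)"
  \<comment> \<open>Chosen so that the logarithm of the threshold \<open>b ^ (L * r)\<close> is a *
    r.\<close>
  define a where "a = real L * ln (real b)"
  have a: "0 < a" using b L by (simp add: a_def)
  define c where "c = (1 / ?d) ^ ?d * a powr (- \<delta>)"
  show "0 < c" using a by (simp add: c_def)
  have "filterlim (\<lambda>r. b ^ (L * r)) at_top sequentially"
  proof (rule filterlim_at_top_mono[OF filterlim_ident])
    show "\<forall>\<^sub>F r in sequentially. r \<le> b ^ (L * r)"
    proof (intro always_eventually allI)
      fix r
      have "r \<le> 2 ^ r" by (simp add: less_imp_le)
      also have "\<dots> \<le> b ^ r" using b by (intro power_mono) auto
      also have "\<dots> \<le> b ^ (L * r)" using b L by (intro power_increasing) auto
      finally show "r \<le> b ^ (L * r)" .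
    qed
  qed
  from eventually_compose_filterlim[OF tail this] eventually_gt_at_top[of 0]
  show "\<forall>\<^sub>F r in sequentially. \<forall>S :: 'd site set. finite S \<longrightarrow> (real r / ?d) ^ ?d \<le> card S \<longrightarrow>
       measure (initial_measure \<mu>) {\<eta>. \<forall>z\<in>S. \<eta> z < b ^ (L * r)} \<le> exp (- c * real r powr (?d - \<delta>))"
  proof eventually_elim
    case (elim r)
    let ?P = "measure_pmf.prob \<mu> {k. k \<ge> b ^ (L * r)}"
    have ln: "ln (real (b ^ (L * r))) = a * r"
      using b by (simp add: ln_realpow a_def)
    have P: "a powr (- \<delta>) * real r powr (- \<delta>) \<le> ?P"
      using elim(1) a elim(2) unfolding ln by (simp add: powr_mult)
    show ?case
    proof (intro allI impI)
      fix S :: "'d site set" assume S: "finite S" "(real r / ?d) ^ ?d \<le> card S"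
      have "measure (initial_measure \<mu>) {\<eta>. \<forall>z\<in>S. \<eta> z < b ^ (L * r)} = (1 - ?P) ^ card S"
        by (rule prob_all_below(1)[OF S(1)])
      also have "\<dots> \<le> exp (- ?P) ^ card S"
        using exp_ge_add_one_self[of "- ?P"] by (intro power_mono) auto
      also have "\<dots> = exp (- (real (card S) * ?P))" by (simp add: exp_of_nat_mult[symmetric])
      also have "\<dots> \<le> exp (- ((real r / ?d) ^ ?d * (a powr (- \<delta>) * real r powr (- \<delta>))))"
        using S(2) P by (auto intro!: mult_mono)
      also have "(real r / ?d) ^ ?d * (a powr (- \<delta>) * real r powr (- \<delta>)) = c * (real r ^ ?d * real r powr (- \<delta>))"
        by (simp add: c_def power_divide)
      also have "real r ^ ?d * real r powr (- \<delta>) = real r powr (?d - \<delta>)"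
        using elim(2) by (simp add: powr_realpow[symmetric] powr_add[symmetric])
      finally show "measure (initial_measure \<mu>) {\<eta>. \<forall>z\<in>S. \<eta> z < b ^ (L * r)} \<le> exp (- c * real r powr (?d - \<delta>))"
        by simp
    qed
  qed
qed

text \<open>The number of centres grows only polynomially in r, and \<delta> < d makes the exponent
  d - \<delta> of the decay positive, so the union bound is summable.\<close>

lemma AE_eventually_rich:
  assumes \<delta>: "\<delta> < real CARD('d::finite)"
    and tail: "\<forall>\<^sub>F n in sequentially. measure_pmf.prob \<mu> {k. k \<ge> n} \<ge> ln (real n) powr (- \<delta>)"
    and b: "2 \<le> b" and L: "1 \<le> L"
  shows "AE \<eta> in initial_measure \<mu>. \<forall>\<^sub>F r in sequentially.
    \<forall>y :: 'd site. norm1 y \<le> r ^ CARD('d) \<longrightarrow> rich b L \<eta> y r"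
proof -
  interpret I: prob_space "initial_measure \<mu> :: ('d site \<Rightarrow> nat) measure"
    by (rule prob_space_initial)
  let ?d = "CARD('d)"
  define poor where "poor = (\<lambda>r y :: 'd site. {\<eta>. \<forall>z\<in>lattice_ball y r. \<eta> z < b ^ (L * r)})"
  define B where "B = (\<lambda>r. \<Union>y\<in>lattice_ball 0 (r ^ ?d). poor r y)"
  have poor_ev: "poor r y \<in> I.events" for r y
    unfolding poor_def by (rule prob_all_below(2)) simp
  obtain c where c: "0 < c"
    and le: "\<forall>\<^sub>F r in sequentially. \<forall>S :: 'd::finite site set. finite S \<longrightarrow> (real r / ?d) ^ ?d \<le> card S \<longrightarrow>
       measure (initial_measure \<mu>) {\<eta>. \<forall>z\<in>S. \<eta> z < b ^ (L * r)} \<le> exp (- c * real r powr (?d - \<delta>))"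
    using prob_all_below_stretched_exp[OF tail b L, where 'd='d] .
  have "AE \<eta> in initial_measure \<mu>. \<forall>\<^sub>F r in sequentially. \<eta> \<notin> B r"
  proof (rule I.AE_eventually_stretched_exp)
    show "B r \<in> I.events" for r unfolding B_def using poor_ev by (intro sets.finite_UN) auto
    show "\<forall>\<^sub>F r in sequentially. I.prob (B r) \<le>
        3 ^ ?d * (real r powr real (?d * ?d) * exp (- c * real r powr (?d - \<delta>)))"
      using le eventually_ge_at_top[of 1]
    proof eventually_elim
      case (elim r)
      have "I.prob (B r) \<le> (\<Sum>y\<in>lattice_ball 0 (r ^ ?d). I.prob (poor r y))"
        unfolding B_def using poor_ev by (intro I.finite_measure_subadditive_finite) auto
      also have "\<dots> \<le> card (lattice_ball (0 :: 'd site) (r ^ ?d)) * exp (- c * real r powr (?d - \<delta>))"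
        using elim(1) card_lattice_ball_ge[where 'd = 'd] unfolding poor_def
        by (intro sum_bounded_above) auto
      also have "\<dots> \<le> (3 * real r ^ ?d) ^ ?d * exp (- c * real r powr (?d - \<delta>))"
      proof (intro mult_right_mono)
        have "real (card (lattice_ball (0 :: 'd site) (r ^ ?d))) \<le> (2 * real r ^ ?d + 1) ^ ?d"
          using real_card_lattice_ball_le[of "0 :: 'd site" "r ^ ?d"] by simp
        also have "\<dots> \<le> (3 * real r ^ ?d) ^ ?d"
          using elim(2) one_le_power[of "real r" ?d] by (intro power_mono) auto
        finally show "real (card (lattice_ball (0 :: 'd site) (r ^ ?d))) \<le> (3 * real r ^ ?d) ^ ?d" .
      qed auto
      also have "(3 * real r ^ ?d) ^ ?d = 3 ^ ?d * real r powr real (?d * ?d)"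
        using elim(2) by (subst powr_realpow) (auto simp: power_mult_distrib power_mult[symmetric])
      finally show ?case by (simp add: mult.assoc)
    qed
  qed (use c \<delta> in auto)
  thus ?thesis
  proof eventually_elim
    case (elim \<eta>)
    thus ?case
    proof eventually_elim
      case (elim r)
      show ?case
      proof (intro allI impI)
        fix y :: "'d site" assume "norm1 y \<le> r ^ ?d"
        hence "\<eta> \<notin> poor r y" using elim by (auto simp: B_def lattice_ball_def)
        thus "rich b L \<eta> y r" by (auto simp: poor_def rich_def not_less)
      qed
    qed
  qed
qed

lemma AE_well_behaved:
  assumes p: "0 < p" "p \<le> 1" and b: "2 \<le> real b * move_prob p TYPE('d::finite)"
    and \<delta>: "\<delta> < real CARD('d)"
    and tail: "\<forall>\<^sub>F n in sequentially. measure_pmf.prob \<mu> {k. k \<ge> n} \<ge> ln (real n) powr (- \<delta>)"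
    and L: "1 \<le> L"
  shows "AE \<omega> in frog_measure \<mu> p. \<exists>r\<^sub>0. well_behaved b L r\<^sub>0 (\<omega> :: 'd sample)"
proof -
  have "real b * move_prob p TYPE('d) \<le> real b * 1"
    using move_prob_bounds[OF p, where 'd='d] by (intro mult_left_mono) auto
  hence b2: "2 \<le> b" using b by simp
  have "AE \<omega> in frog_measure \<mu> p. \<forall>\<^sub>F r in sequentially.
    \<forall>y :: 'd site. norm1 y \<le> r ^ CARD('d) \<longrightarrow> rich b L (init_particles \<omega>) y r"
    using AE_fst_pair[OF prob_space_motion AE_eventually_rich[OF \<delta> tail b2 L]]
    unfolding frog_measure_def init_particles_def .
  with AE_eventually_covering[OF p b] show ?thesis
  proof eventually_elim
    case (elim \<omega>)
    from eventually_conj[OF elim] show ?case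
      unfolding eventually_sequentially well_behaved_def by blast
  qed
qed


section \<open>The first particle\<close>

text \<open>At the least k with \<open>r \<le> f k\<close> the value cannot overshoot, as f
  increases by at most one per step. It is applied to the distance of a walk from the origin and to
  its number of jumps.\<close>

lemma nat_intermediate_value:
  fixes f :: "nat \<Rightarrow> nat"
  assumes "f 0 = 0" "\<And>k. f (Suc k) \<le> f k + 1" "\<And>n. \<exists>k. n \<le> f k"
  shows "\<exists>k. f k = r"
proof
  define k where "k = (LEAST k. r \<le> f k)"
  have k: "r \<le> f k" unfolding k_def using assms(3) by (rule LeastI_ex)
  show "f k = r"
  proof (cases k)
    case 0
    thus ?thesis using k assms(1) by simp
  next
    case (Suc l)
    hence "f l < r" using not_less_Least[of l "\<lambda>k. r \<le> f k"] unfolding k_def by simp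
    thus ?thesis using k assms(2)[of l] Suc by simp
  qed
qed

lemma AE_unit_increments:
  "AE w in (walks_measure :: ('d::finite site \<times> nat \<times> nat \<Rightarrow> 'd site) measure). \<forall>i. w i \<in> unit_steps"
  unfolding AE_all_countable
proof
  fix i :: "'d site \<times> nat \<times> nat"
  have "AE u in measure_pmf (pmf_of_set unit_steps :: 'd site pmf). u \<in> unit_steps"
    using AE_measure_pmf[of "pmf_of_set unit_steps :: 'd site pmf"] by simp
  thus "AE w in walks_measure. w i \<in> (unit_steps :: 'd site set)"
    by (intro AE_PiM_component[where P = "\<lambda>u. u \<in> unit_steps"] prob_space_measure_pmf) auto
qed

text \<open>The windows of length n of the first particle at the origin are disjoint, and each is a
  straight run without pause with the same positive probability, so almost surely one of them
  succeeds. This replaces any recurrence or transience theory of the walk.\<close>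

lemma AE_straight_runs:
  fixes u :: "'d::finite site"
  assumes p: "0 < p" "p \<le> 1" and u: "u \<in> unit_steps"
  shows "AE wc in motion_measure p. \<forall>n. \<exists>j. \<forall>i<n. wc \<in> moves_along (\<lambda>_. u) (0, 1, j * n + i)"
  unfolding AE_all_countable
proof
  fix n :: nat
  interpret M: prob_space "motion_measure p :: (('d site \<times> nat \<times> nat \<Rightarrow> 'd site) \<times> _) measure"
    by (rule prob_space_motion)
  let ?q = "move_prob p TYPE('d)"
  define I where "I = (\<lambda>j. (\<lambda>i. (0 :: 'd site, 1 :: nat, j * n + i)) ` {..<n})"
  have card_I: "card (I j) = n" for j
    unfolding I_def by (subst card_image) (auto simp: inj_on_def)
  have "(j * n + i) div n = j" if "i < n" for i j
    using that by simp
  hence "j = j'" if "i < n" "i' < n" "j * n + i = j' * n + i'" for i i' j j'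
    using that by metis
  hence disj: "disjoint_family_on I J" for J
    unfolding disjoint_family_on_def I_def by blast
  define B where "B = (\<lambda>J. \<Inter>j\<in>{..<J}. - (\<Inter>i\<in>I j. moves_along (\<lambda>_. u) i))"
  have B_prob: "M.prob (B J) = (1 - ?q ^ n) ^ J" for J
    unfolding B_def using p u by (subst prob_no_block_moves(1)[OF _ _ _ _ _ card_I disj]) (auto simp: I_def)
  have B_ev: "B J \<in> M.events" for J
    unfolding B_def using p u by (intro prob_no_block_moves(2)[OF _ _ _ _ _ card_I disj]) (auto simp: I_def)
  have "M.prob (\<Inter>J. B J) \<le> (1 - ?q ^ n) ^ J" for J
    using M.finite_measure_mono[of "\<Inter>J. B J" "B J"] B_ev B_prob[of J] by auto
  moreover have "(\<lambda>J. (1 - ?q ^ n) ^ J) \<longlonglongrightarrow> 0"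
    using move_prob_bounds[OF p, where 'd='d] by (intro LIMSEQ_power_zero) (auto simp: power_le_one)
  ultimately have "M.prob (\<Inter>J. B J) \<le> 0"
    by (intro LIMSEQ_le_const) auto
  hence "(\<Inter>J. B J) \<in> null_sets (motion_measure p)"
    using B_ev by (auto simp: null_sets_def M.emeasure_eq_measure measure_le_0_iff)
  hence "AE wc in motion_measure p. wc \<notin> (\<Inter>J. B J)" by (rule AE_not_in)
  thus "AE wc in motion_measure p. \<exists>j. \<forall>i<n. wc \<in> moves_along (\<lambda>_. u) (0, 1, j * n + i)"
    by eventually_elim (auto simp: B_def I_def)
qed

lemma norm1_straight: "norm1 (\<Sum>i<n. axis a 1 :: 'd::finite site) = n"
proof -
  have "norm1 (\<Sum>i<n. axis a 1 :: 'd site) = (\<Sum>j\<in>UNIV. if j = a then n else 0)"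
    unfolding norm1_def by (intro sum.cong) (auto simp: axis_def of_nat_index)
  thus ?thesis by simp
qed

text \<open>The first particle at the origin has sites at every distance on its path, hence pairwise
  distinct ones, and reaches each site of the path in finite time because its clock never stops
  ticking for good.\<close>

definition roaming :: "'d::finite sample \<Rightarrow> bool" where
  "roaming \<omega> \<longleftrightarrow> (\<forall>r. \<exists>m. norm1 (walk_path \<omega> 0 1 m) = r) \<and> (\<forall>m. \<exists>k. num_jumps \<omega> 0 1 k = m)"

lemma walk_path_Suc: "walk_path \<omega> x j (Suc m) = walk_path \<omega> x j m + walk_increment \<omega> x j m"
  by (simp add: walk_path_def)

lemma roamingI:
  fixes \<omega> :: "'d::finite sample"
  assumes unit: "\<And>m. walk_increment \<omega> 0 1 m \<in> unit_steps"
    and run: "\<And>n. \<exists>j. \<forall>i<n. walk_increment \<omega> 0 1 (j + i) = axis a 1 \<and> clock_tick \<omega> 0 1 (j + i)"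
  shows "roaming \<omega>"
  unfolding roaming_def
proof (intro conjI allI)
  fix r
  show "\<exists>m. norm1 (walk_path \<omega> 0 1 m) = r"
  proof (rule nat_intermediate_value)
    show "norm1 (walk_path \<omega> 0 1 0) = 0" by (simp add: walk_path_def)
    show "norm1 (walk_path \<omega> 0 1 (Suc k)) \<le> norm1 (walk_path \<omega> 0 1 k) + 1" for k
      using norm1_triangle[of "walk_path \<omega> 0 1 k" "walk_increment \<omega> 0 1 k"] norm1_unit_step[OF unit[of k]]
      by (simp add: walk_path_Suc)
    fix n
    \<comment> \<open>The endpoints of a straight run of length 2n are 2n apart, so one of them is
      at distance at least n from the origin.\<close>
    from run[of "2 * n"] obtain j where
      j: "\<And>i. i < 2 * n \<Longrightarrow> walk_increment \<omega> 0 1 (j + i) = axis a 1" by blast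
    have "i \<le> 2 * n \<Longrightarrow> walk_path \<omega> 0 1 (j + i) - walk_path \<omega> 0 1 j = (\<Sum>i<i. axis a 1)" for i
      by (induction i) (use j in \<open>auto simp: walk_path_Suc algebra_simps\<close>)
    from this[of "2 * n"] have "norm1 (walk_path \<omega> 0 1 (j + 2 * n) - walk_path \<omega> 0 1 j) = 2 * n"
      by (simp only: norm1_straight)
    hence "2 * n \<le> norm1 (walk_path \<omega> 0 1 (j + 2 * n)) + norm1 (walk_path \<omega> 0 1 j)"
      using norm1_triangle_diff[of "walk_path \<omega> 0 1 (j + 2 * n)" "walk_path \<omega> 0 1 j" 0]
by simp
    hence "n \<le> norm1 (walk_path \<omega> 0 1 (j + 2 * n)) \<or> n \<le> norm1 (walk_path \<omega> 0 1 j)" by linarith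
    thus "\<exists>k. n \<le> norm1 (walk_path \<omega> 0 1 k)" by blast
  qed
next
  fix m
  show "\<exists>k. num_jumps \<omega> 0 1 k = m"
  proof (rule nat_intermediate_value)
    show "num_jumps \<omega> 0 1 0 = 0" by (simp add: num_jumps_def)
    show "num_jumps \<omega> 0 1 (Suc k) \<le> num_jumps \<omega> 0 1 k + 1" for k by (simp add: num_jumps_Suc)
    fix n
    from run[of n] obtain j where j: "\<And>i. i < n \<Longrightarrow> clock_tick \<omega> 0 1 (j + i)" by blast
    have "i \<le> n \<Longrightarrow> i \<le> num_jumps \<omega> 0 1 (j + i)" for i
      by (induction i) (use j in \<open>auto simp: num_jumps_Suc\<close>)
    thus "\<exists>k. n \<le> num_jumps \<omega> 0 1 k" by blast
  qed
qed

text \<open>Roaming depends on the motion only. The quantifier over \<eta> inside the almost sure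
  statement lets the motion be frozen while the initial numbers remain random.\<close>

lemma AE_roaming:
  assumes p: "0 < p" "p \<le> 1"
  shows "AE wc in motion_measure p. \<forall>\<eta>. roaming ((\<eta>, wc) :: 'd::finite sample)"
proof -
  define e where "e = (axis undefined 1 :: 'd site)"
  have "e \<in> unit_steps" by (auto simp: e_def unit_steps_def)
  note AE_straight_runs[OF p this]
  moreover have "AE wc in motion_measure p. \<forall>i. (fst wc i :: 'd site) \<in> unit_steps"
    using AE_fst_pair[OF prob_space_PiM_pmf AE_unit_increments] .
  ultimately show ?thesis
  proof eventually_elim
    case (elim wc)
    show ?case
    proof
      fix \<eta>
      show "roaming (\<eta>, wc)"
      proof (rule roamingI)
        show "walk_increment (\<eta>, wc) 0 1 m \<in> unit_steps" for m
          using elim(2) by (simp add: walk_increment_def)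
        fix n
        from elim(1) obtain j where "\<And>i. i < n \<Longrightarrow> wc \<in> moves_along (\<lambda>_. e) (0, 1, j * n + i)" by blast
        hence "\<forall>i<n. walk_increment (\<eta>, wc) 0 1 (j * n + i) = axis undefined 1 \<and> clock_tick (\<eta>, wc) 0 1 (j * n + i)"
          using moves_along_block[OF refl, of wc "\<lambda>_. e" 0 1] by (simp add: e_def)
        thus "\<exists>j. \<forall>i<n. walk_increment (\<eta>, wc) 0 1 (j + i) = axis undefined 1 \<and> clock_tick (\<eta>, wc) 0 1 (j + i)" ..
      qed
    qed
  qed
qed

section \<open>Independence of the first walk and the initial numbers\<close>

lemma measurable_init_particles [measurable]:
  "(\<lambda>\<omega>. init_particles \<omega> x) \<in> frog_measure \<mu> p \<rightarrow>\<^sub>M count_space UNIV"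
proof -
  have "(\<lambda>\<eta>. \<eta> x) \<in> initial_measure \<mu> \<rightarrow>\<^sub>M count_space UNIV"
    unfolding initial_measure_def
    using measurable_component_singleton[of x UNIV "\<lambda>_. measure_pmf \<mu>"] by simp
  thus ?thesis unfolding frog_measure_def init_particles_def by (rule measurable_compose[OF measurable_fst])
qed

lemma measurable_walk_increment [measurable]:
  "(\<lambda>\<omega>. walk_increment \<omega> x j m) \<in> frog_measure \<mu> p \<rightarrow>\<^sub>M count_space UNIV"
proof -
  have "(\<lambda>w. w (x, j, m)) \<in> walks_measure \<rightarrow>\<^sub>M count_space UNIV"
    using measurable_component_singleton[of "(x, j, m)" UNIV "\<lambda>_. measure_pmf (pmf_of_set unit_steps)"] by simp
  thus ?thesis unfolding frog_measure_def walk_increment_def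
    by (intro measurable_compose[OF measurable_compose[OF measurable_snd measurable_fst]])
qed

lemma measurable_walk_path [measurable]:
  "(\<lambda>\<omega>. walk_path \<omega> x j m) \<in> frog_measure \<mu> p \<rightarrow>\<^sub>M count_space UNIV"
proof (induction m)
  case 0
  thus ?case by (simp add: walk_path_def)
next
  case (Suc m)
  show ?case unfolding walk_path_Suc
    by (rule measurable_compose_countable[OF _ Suc])
      (rule measurable_compose[OF measurable_walk_increment], simp)
qed

text \<open>With the motion frozen, the path supplies r ^ d deterministic sites, one at each
  distance from 1 to r ^ d, and the initial numbers there are independent. Hence all of them are
  poor only with stretched exponentially small probability, and Borel-Cantelli applies. Fubini then
  carries this over to the joint space.\<close>

lemma AE_visits_rich_site:
  assumes p: "0 < p" "p \<le> 1" and \<delta>: "\<delta> < real CARD('d::finite)"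
    and tail: "\<forall>\<^sub>F n in sequentially. measure_pmf.prob \<mu> {k. k \<ge> n} \<ge> ln (real n) powr (- \<delta>)"
    and b: "2 \<le> b"
  shows "AE \<omega> in frog_measure \<mu> p. \<forall>\<^sub>F r in sequentially. \<exists>m.
    norm1 (walk_path \<omega> (0 :: 'd site) 1 m) \<le> r ^ CARD('d) \<and> b ^ r \<le> init_particles \<omega> (walk_path \<omega> 0 1 m)"
    (is "AE \<omega> in _. ?P \<omega>")
proof -
  interpret I: prob_space "initial_measure \<mu> :: ('d site \<Rightarrow> nat) measure"
    by (rule prob_space_initial)
  interpret M: prob_space "motion_measure p :: (('d site \<times> nat \<times> nat \<Rightarrow> 'd site) \<times> _) measure"
    by (rule prob_space_motion)
  interpret pair_sigma_finite "initial_measure \<mu> :: ('d site \<Rightarrow> nat) measure"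
    "motion_measure p :: (('d site \<times> nat \<times> nat \<Rightarrow> 'd site) \<times> _) measure" ..
  let ?d = "CARD('d)"
  \<comment> \<open>Exchanging the order of the two almost sure quantifiers requires a measurable
    event; the random site at which the initial number is read takes only countably many
    values.\<close>
  have "{\<omega> \<in> space (frog_measure \<mu> p). ?P \<omega>} \<in> sets (frog_measure \<mu> p)"
  proof -
    have "(\<lambda>\<omega>. init_particles \<omega> (walk_path \<omega> 0 1 m)) \<in> frog_measure \<mu> p \<rightarrow>\<^sub>M count_space UNIV" for m
      by (rule measurable_compose_countable[OF measurable_init_particles measurable_walk_path])
    note [measurable] = this
    show ?thesis unfolding eventually_sequentially by measurable
  qed
  hence sets: "{\<omega> \<in> space (initial_measure \<mu> \<Otimes>\<^sub>M motion_measure p). ?P \<omega>} \<in> sets (initial_measure \<mu> \<Otimes>\<^sub>M motion_measure p)"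
    by (simp only: frog_measure_def)
  obtain c where c: "0 < c"
    and le: "\<forall>\<^sub>F r in sequentially. \<forall>S :: 'd::finite site set. finite S \<longrightarrow> (real r / ?d) ^ ?d \<le> card S \<longrightarrow>
       measure (initial_measure \<mu>) {\<eta>. \<forall>z\<in>S. \<eta> z < b ^ (1 * r)} \<le> exp (- c * real r powr (?d - \<delta>))"
    using prob_all_below_stretched_exp[OF tail b le_refl, where 'd='d] .
  have "AE wc in motion_measure p. AE \<eta> in initial_measure \<mu>. ?P (\<eta>, wc)"
    using AE_roaming[OF p]
  proof eventually_elim
    case (elim wc)
    \<comment> \<open>The zero configuration is a dummy: the path does not depend on the initial
      numbers, as \<open>v_eq\<close> records.\<close>
    have "\<exists>m. norm1 (walk_path (\<lambda>_. 0, wc) (0 :: 'd site) 1 m) = r" for r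
      using elim by (simp add: roaming_def)
    then obtain f where f: "\<And>r. norm1 (walk_path (\<lambda>_. 0, wc) (0 :: 'd site) 1 (f r)) = r" by metis
    define v where "v = (\<lambda>r. walk_path (\<lambda>_. 0, wc) (0 :: 'd site) 1 (f r))"
    have v: "norm1 (v r) = r" for r using f by (simp add: v_def)
    have v_eq: "v r = walk_path (\<eta>, wc) 0 1 (f r)" for r \<eta>
      by (simp add: v_def walk_path_def walk_increment_def)
    define S where "S = (\<lambda>r. v ` {1..r ^ ?d})"
    have card_S: "card (S r) = r ^ ?d" for r
      unfolding S_def by (subst card_image) (auto intro!: inj_onI, metis v)
    define B where "B = (\<lambda>r. {\<eta>. \<forall>z\<in>S r. \<eta> z < b ^ (1 * r)})"
    have "AE \<eta> in initial_measure \<mu>. \<forall>\<^sub>F r in sequentially. \<eta> \<notin> B r"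
    proof (rule I.AE_eventually_stretched_exp)
      show "B r \<in> I.events" for r unfolding B_def by (rule prob_all_below(2)) (simp add: S_def)
      show "\<forall>\<^sub>F r in sequentially. I.prob (B r) \<le> 1 * (real r powr 0 * exp (- c * real r powr (?d - \<delta>)))"
        using le eventually_gt_at_top[of 0]
      proof eventually_elim
        case (elim r)
        have "real r / ?d \<le> real r" by (simp add: divide_le_eq mult_le_cancel_left1)
        hence "(real r / ?d) ^ ?d \<le> real r ^ ?d" by (rule power_mono) simp
        hence "I.prob (B r) \<le> exp (- c * real r powr (?d - \<delta>))"
          using elim(1)[rule_format, of "S r"] card_S[of r] unfolding B_def by (simp add: S_def)
        thus ?case using elim(2) by simp
      qed
    qed (use c \<delta> in auto)
    thus ?case
    proof eventually_elim
      case (elim \<eta>)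
      thus ?case
      proof eventually_elim
        case (elim r)
        then obtain s where s: "s \<in> {1..r ^ ?d}" "b ^ r \<le> \<eta> (v s)" by (auto simp: B_def S_def not_less)
        hence "norm1 (v s) \<le> r ^ ?d" using v by simp
        thus ?case using s(2) unfolding v_eq[of s \<eta>] by (auto simp: init_particles_def)
      qed
    qed
  qed
  hence "AE \<eta> in initial_measure \<mu>. AE wc in motion_measure p. ?P (\<eta>, wc)"
    using sets by (subst AE_commute) simp_all
  thus ?thesis unfolding frog_measure_def by (rule AE_pair_measure[OF sets])
qed


section \<open>The limit shape\<close>

text \<open>The first particle at the origin is active from time 0 and eventually carries the
  discovery to a site rich enough to start the doubling.\<close>

lemma everything_discovered:
  fixes \<omega> :: "'d::finite sample"
  assumes wb: "well_behaved b L r\<^sub>0 \<omega>" and L: "3 \<le> L" and roam: "roaming \<omega>"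
    and rich: "\<forall>\<^sub>F r in sequentially. \<exists>m.
      norm1 (walk_path \<omega> (0 :: 'd site) 1 m) \<le> r ^ CARD('d) \<and> b ^ r \<le> init_particles \<omega> (walk_path \<omega> 0 1 m)"
    and origin: "1 \<le> init_particles \<omega> 0"
  shows "\<exists>n. x \<in> discovered \<omega> n"
proof -
  from eventually_happens'[OF sequentially_bot eventually_conj[OF rich eventually_ge_at_top[of "max r\<^sub>0 1"]]]
  obtain r m where r: "r\<^sub>0 \<le> r" "1 \<le> r" and m: "norm1 (walk_path \<omega> (0 :: 'd site) 1 m) \<le> r ^ CARD('d)"
    "b ^ r \<le> init_particles \<omega> (walk_path \<omega> 0 1 m)" by auto
  from roam obtain k where "num_jumps \<omega> 0 1 k = m" by (auto simp: roaming_def)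
  hence "walk_path \<omega> 0 1 m \<in> discovered \<omega> (0 + k)"
    using discovered_step[of 0 \<omega> 0 1 k] origin origin_discovered[of \<omega> 0] by (simp add: particle_position_def)
  from well_behaved_discovers_everything[OF wb r L m(1) this m(2)] show ?thesis .
qed

text \<open>The ball of radius m is filled by time c + (1 + \<epsilon>) m. For m up to (1 -
  \<epsilon>) n + a this is n minus \<epsilon>^2 n plus a constant, hence at most n for large n. The
  shift a leaves room for passing from real points to lattice sites.\<close>

lemma AE_lattice_ball_discovered:
  fixes \<delta> \<epsilon> a :: real
  assumes p: "0 < p" "p \<le> 1" and \<delta>: "\<delta> < real CARD('d::finite)"
    and tail: "\<forall>\<^sub>F n in sequentially. measure_pmf.prob \<mu> {k. k \<ge> n} \<ge> ln (real n) powr (- \<delta>)"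
    and \<epsilon>: "0 < \<epsilon>" "\<epsilon> < 1"
  shows "AE \<omega> in frog_measure \<mu> p. 1 \<le> init_particles \<omega> (0 :: 'd site) \<longrightarrow>
    (\<forall>\<^sub>F n in sequentially. \<forall>x. real (norm1 x) \<le> (1 - \<epsilon>) * real n + a \<longrightarrow> x \<in> discovered \<omega> n)"
proof -
  \<comment> \<open>This makes the overhead 5 (m div l) at most \<epsilon> m.\<close>
  define l where "l = nat \<lceil>5 / \<epsilon>\<rceil>"
  have l: "5 / \<epsilon> \<le> l" unfolding l_def by (rule real_nat_ceiling_ge)
  moreover have "5 \<le> 5 / \<epsilon>" using \<epsilon> by (simp add: field_simps)
  ultimately have l2: "2 \<le> l" by linarith
  let ?q = "move_prob p TYPE('d)"
  note q = move_prob_bounds[OF p, where 'd='d]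
  define b where "b = nat \<lceil>2 / ?q\<rceil>"
  have "2 / ?q \<le> b" unfolding b_def by (rule real_nat_ceiling_ge)
  hence b: "2 \<le> real b * ?q" using q by (simp add: field_simps)
  also have "\<dots> \<le> real b * 1" using q by (intro mult_left_mono) auto
  finally have b2: "2 \<le> b" by simp
  have "AE \<omega> in frog_measure \<mu> p. roaming (\<omega> :: 'd sample)"
    using AE_snd_pair[OF prob_space_initial prob_space_motion AE_roaming[OF p]]
    unfolding frog_measure_def by eventually_elim (metis prod.collapse)
  moreover have "AE \<omega> in frog_measure \<mu> p. \<exists>r\<^sub>0. well_behaved b (l + 1) r\<^sub>0 (\<omega> :: 'd sample)"
    by (rule AE_well_behaved[OF p b \<delta> tail]) simp
  moreover note AE_visits_rich_site[OF p \<delta> tail b2]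
  ultimately show ?thesis
  proof eventually_elim
    case (elim \<omega>)
    from elim(2) obtain r\<^sub>0 where wb: "well_behaved b (l + 1) r\<^sub>0 \<omega>" ..
    show ?case
    proof
      assume "1 \<le> init_particles \<omega> 0"
      hence "\<exists>n. x \<in> discovered \<omega> n" for x
        using l2 by (intro everything_discovered[OF wb _ elim(1,3)]) auto
      from well_behaved_unit_speed[OF wb l2 this] obtain c where
        c: "\<And>m. lattice_ball 0 m \<subseteq> discovered \<omega> (c + m + 5 * (m div l))" by blast
      have "\<forall>\<^sub>F n in sequentially. c + (1 + \<epsilon>) * a \<le> \<epsilon>\<^sup>2 * real n"
        using \<epsilon> by real_asymp
      thus "\<forall>\<^sub>F n in sequentially. \<forall>x. real (norm1 x) \<le> (1 - \<epsilon>) * real n + a \<longrightarrow> x \<in> discovered \<omega> n"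
      proof eventually_elim
        case (elim n)
        show ?case
        proof (intro allI impI)
          fix x :: "'d site" assume x: "real (norm1 x) \<le> (1 - \<epsilon>) * real n + a"
          let ?m = "norm1 x"
          have "5 * real (?m div l) \<le> 5 * (real ?m / real l)"
            by (intro mult_left_mono of_nat_div_le_of_nat) simp
          also have "\<dots> = 5 / real l * real ?m" by simp
          also have "5 / real l \<le> \<epsilon>" using l \<epsilon> l2 by (simp add: field_simps)
          finally have "real (c + ?m + 5 * (?m div l)) \<le> c + (1 + \<epsilon>) * real ?m"
            by (simp add: algebra_simps mult_right_mono)
          also have "\<dots> \<le> c + (1 + \<epsilon>) * ((1 - \<epsilon>) * real n + a)"
            using x \<epsilon> by (intro add_left_mono mult_left_mono) auto
          also have "\<dots> = c + (1 + \<epsilon>) * a + (real n - \<epsilon>\<^sup>2 * real n)"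
            by (simp add: algebra_simps power2_eq_square)
          also have "\<dots> \<le> real n" using elim by linarith
          finally have "c + ?m + 5 * (?m div l) \<le> n" by linarith
          moreover have "x \<in> discovered \<omega> (c + ?m + 5 * (?m div l))"
            using c[of ?m] by (auto simp: lattice_ball_def)
          ultimately show "x \<in> discovered \<omega> n" using discovered_mono by blast
        qed
      qed
    qed
  qed
qed

section \<open>The L1 norm and the cells around lattice sites\<close>

lemma real_norm1: "real (norm1 x) = (\<Sum>i\<in>UNIV. \<bar>real_of_int (x $ i)\<bar>)"
  unfolding norm1_def of_nat_sum by (intro sum.cong) auto

lemma L1_norm_scaleR: "L1_norm (c *\<^sub>R x) = \<bar>c\<bar> * L1_norm x"
  by (simp add: L1_norm_def abs_mult sum_distrib_left)

lemma L1_norm_triangle: "L1_norm (x + y) \<le> L1_norm x + L1_norm y"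
  unfolding L1_norm_def sum.distrib[symmetric] by (intro sum_mono) (simp add: abs_triangle_ineq)

lemma closed_L1_unit_ball: "closed (L1_unit_ball :: (real ^ 'd::finite) set)"
  unfolding L1_unit_ball_def L1_norm_def
  by (intro closed_Collect_le continuous_intros)

lemma convex_L1_unit_ball: "convex (L1_unit_ball :: (real ^ 'd::finite) set)"
proof (rule convexI)
  fix x y :: "real ^ 'd" and u v :: real
  assume *: "x \<in> L1_unit_ball" "y \<in> L1_unit_ball" "0 \<le> u" "0 \<le> v" "u + v = 1"
  have "L1_norm (u *\<^sub>R x + v *\<^sub>R y) \<le> u * L1_norm x + v * L1_norm y"
    using L1_norm_triangle[of "u *\<^sub>R x" "v *\<^sub>R y"] * by (simp add: L1_norm_scaleR)
  also have "\<dots> \<le> u * 1 + v * 1"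
    using * by (intro add_mono mult_left_mono) (auto simp: L1_unit_ball_def)
  finally show "u *\<^sub>R x + v *\<^sub>R y \<in> L1_unit_ball" using * by (simp add: L1_unit_ball_def)
qed

lemma L1_norm_discovered_region:
  fixes \<omega> :: "'d::finite sample"
  assumes "\<And>y j m. walk_increment \<omega> y j m \<in> unit_steps" "y \<in> discovered_region \<omega> n"
  shows "L1_norm y \<le> real n + CARD('d) / 2"
proof -
  from assms(2) obtain x where x: "x \<in> discovered \<omega> n"
    "\<And>i. - 1/2 < y $ i - of_int (x $ i) \<and> y $ i - of_int (x $ i) \<le> 1/2"
    unfolding discovered_region_def by blast
  have "L1_norm y \<le> (\<Sum>i\<in>UNIV. \<bar>real_of_int (x $ i)\<bar> + 1 / 2)"
    unfolding L1_norm_def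
  proof (rule sum_mono)
    fix i show "\<bar>y $ i\<bar> \<le> \<bar>real_of_int (x $ i)\<bar> + 1 / 2" using x(2)[of i] by linarith
  qed
  also have "\<dots> = real (norm1 x) + CARD('d) / 2" by (simp add: real_norm1 sum.distrib)
  also have "\<dots> \<le> real n + CARD('d) / 2" using discovered_norm1_le[OF assms(1) x(1)] by simp
  finally show ?thesis .
qed

lemma in_discovered_region:
  fixes v :: "real ^ 'd::finite"
  assumes "\<And>x. real (norm1 x) \<le> L1_norm v + CARD('d) / 2 \<Longrightarrow> x \<in> discovered \<omega> n"
  shows "v \<in> discovered_region \<omega> n"
proof -
  \<comment> \<open>The ceiling of v - 1/2 fits cells that are open on the left and closed on the
    right.\<close>
  define x where "x = (\<chi> i. \<lceil>v $ i - 1 / 2\<rceil>)"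
  have x: "- 1/2 < v $ i - of_int (x $ i) \<and> v $ i - of_int (x $ i) \<le> 1/2" for i
    unfolding x_def by simp linarith
  have "real (norm1 x) \<le> (\<Sum>i\<in>UNIV. \<bar>v $ i\<bar> + 1 / 2)"
    unfolding real_norm1
  proof (rule sum_mono)
    fix i show "\<bar>real_of_int (x $ i)\<bar> \<le> \<bar>v $ i\<bar> + 1 / 2" using x[of i] by linarith
  qed
  also have "\<dots> = L1_norm v + CARD('d) / 2" by (simp add: L1_norm_def sum.distrib)
  finally have "x \<in> discovered \<omega> n" by (rule assms)
  thus ?thesis unfolding discovered_region_def using x by blast
qed

lemma sets_origin_occupied:
  "{\<omega> \<in> space (frog_measure \<mu> p). init_particles \<omega> (0 :: 'd::finite site) \<ge> 1} \<in> sets (frog_measure \<mu> p)"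
  by measurable

text \<open>The inner inclusion comes from the spread, the outer one from the unit speed limit. Each
  loses d / 2 to the cells, which the shift a covers in the first case and \<epsilon> n in the
  second.\<close>

lemma L1_unit_ball_is_limit_shape:
  fixes \<delta> :: real
  assumes p: "0 < p" "p \<le> 1" and \<delta>: "\<delta> < real CARD('d::finite)"
    and tail: "\<forall>\<^sub>F n in sequentially. measure_pmf.prob \<mu> {k. k \<ge> n} \<ge> ln (real n) powr (- \<delta>)"
  shows "is_limit_shape \<mu> p (L1_unit_ball :: (real ^ 'd) set)"
  unfolding is_limit_shape_def
proof (intro conjI allI impI closed_L1_unit_ball convex_L1_unit_ball)
  have "0 \<in> (L1_unit_ball :: (real ^ 'd) set)" by (simp add: L1_unit_ball_def L1_norm_def)
  thus "L1_unit_ball \<noteq> ({} :: (real ^ 'd) set)" by blast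
  fix \<epsilon> :: real assume "0 < \<epsilon> \<and> \<epsilon> < 1"
  hence \<epsilon>: "0 < \<epsilon>" "\<epsilon> < 1" by auto
  have "AE \<omega> in frog_measure \<mu> p. \<forall>i. fst (snd \<omega>) i \<in> (unit_steps :: 'd site set)"
    unfolding frog_measure_def
    by (intro AE_snd_pair[where P = "\<lambda>wc. \<forall>i. fst wc i \<in> unit_steps"] prob_space_initial prob_space_motion
        AE_fst_pair[OF prob_space_PiM_pmf AE_unit_increments])
  moreover note AE_lattice_ball_discovered[OF p \<delta> tail \<epsilon>, of "CARD('d) / 2"]
  ultimately have "AE \<omega> in frog_measure \<mu> p. 1 \<le> init_particles \<omega> (0 :: 'd site) \<longrightarrow>
    (\<forall>\<^sub>F n in sequentially.
      (\<lambda>a. (1 - \<epsilon>) *\<^sub>R a) ` L1_unit_ball \<subseteq> (\<lambda>y. y /\<^sub>R real n) ` discovered_region \<omega> n \<and>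
      (\<lambda>y. y /\<^sub>R real n) ` discovered_region \<omega> n \<subseteq> (\<lambda>a. (1 + \<epsilon>) *\<^sub>R a) ` L1_unit_ball)"
  proof eventually_elim
    case (elim \<omega>)
    have unit: "walk_increment \<omega> y j m \<in> unit_steps" for y j m
      using elim(1) by (simp add: walk_increment_def)
    show ?case
    proof
      assume "1 \<le> init_particles \<omega> (0 :: 'd site)"
      with elim(2) have "\<forall>\<^sub>F n in sequentially. \<forall>x. real (norm1 x) \<le> (1 - \<epsilon>) * real n + CARD('d) / 2 \<longrightarrow> x \<in> discovered \<omega> n"
        by blast
      moreover have "\<forall>\<^sub>F n in sequentially. CARD('d) / 2 \<le> \<epsilon> * real n"
        using \<epsilon> by real_asymp
      ultimately show "\<forall>\<^sub>F n in sequentially.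
        (\<lambda>a. (1 - \<epsilon>) *\<^sub>R a) ` L1_unit_ball \<subseteq> (\<lambda>y. y /\<^sub>R real n) ` discovered_region \<omega> n \<and>
        (\<lambda>y. y /\<^sub>R real n) ` discovered_region \<omega> n \<subseteq> (\<lambda>a. (1 + \<epsilon>) *\<^sub>R a) ` L1_unit_ball"
        using eventually_gt_at_top[of 0]
      proof eventually_elim
        case (elim n)
        have "(1 - \<epsilon>) *\<^sub>R a \<in> (\<lambda>y. y /\<^sub>R real n) ` discovered_region \<omega> n" if a: "a \<in> L1_unit_ball" for a
        proof (rule image_eqI)
          let ?v = "(real n * (1 - \<epsilon>)) *\<^sub>R a"
          show "(1 - \<epsilon>) *\<^sub>R a = ?v /\<^sub>R real n" using elim(3) by simp
          have "L1_norm ?v = (1 - \<epsilon>) * real n * L1_norm a"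
            using \<epsilon> by (simp add: L1_norm_scaleR abs_mult)
          also have "\<dots> \<le> (1 - \<epsilon>) * real n * 1"
            using \<epsilon> a by (intro mult_left_mono) (auto simp: L1_unit_ball_def)
          finally show "?v \<in> discovered_region \<omega> n"
            using elim(1) by (intro in_discovered_region) auto
        qed
        moreover have "y /\<^sub>R real n \<in> (\<lambda>a. (1 + \<epsilon>) *\<^sub>R a) ` L1_unit_ball" if y: "y \<in> discovered_region \<omega> n" for y
        proof (rule image_eqI)
          let ?a = "y /\<^sub>R (real n * (1 + \<epsilon>))"
          have "inverse (real n) = (1 + \<epsilon>) * inverse (real n * (1 + \<epsilon>))" using \<epsilon> by simp
          thus "y /\<^sub>R real n = (1 + \<epsilon>) *\<^sub>R ?a" by (simp only: scaleR_scaleR)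
          have "L1_norm y \<le> real n * (1 + \<epsilon>)"
            using L1_norm_discovered_region[OF unit y] elim(2) by (simp add: algebra_simps)
          moreover have "0 < real n * (1 + \<epsilon>)" using \<epsilon> elim(3) by simp
          moreover from this have "L1_norm ?a = L1_norm y / (real n * (1 + \<epsilon>))"
            by (simp only: L1_norm_scaleR abs_inverse abs_of_pos divide_inverse mult.commute)
          ultimately show "?a \<in> L1_unit_ball"
            by (simp only: L1_unit_ball_def mem_Collect_eq divide_le_eq_1_pos)
        qed
        ultimately show ?case by blast
      qed
    qed
  qed
  hence *: "AE \<omega> in frog_measure \<mu> p. \<omega> \<in> {\<omega> \<in> space (frog_measure \<mu> p). init_particles \<omega> (0 :: 'd site) \<ge> 1} \<longrightarrow>
    (\<forall>\<^sub>F n in sequentially.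
      (\<lambda>a. (1 - \<epsilon>) *\<^sub>R a) ` L1_unit_ball \<subseteq> (\<lambda>y. y /\<^sub>R real n) ` discovered_region \<omega> n \<and>
      (\<lambda>y. y /\<^sub>R real n) ` discovered_region \<omega> n \<subseteq> (\<lambda>a. (1 + \<epsilon>) *\<^sub>R a) ` L1_unit_ball)"
    by eventually_elim blast
  show "AE \<omega> in uniform_measure (frog_measure \<mu> p) {\<omega> \<in> space (frog_measure \<mu> p). init_particles \<omega> (0 :: 'd site) \<ge> 1}.
    \<forall>\<^sub>F n in sequentially.
      (\<lambda>a. (1 - \<epsilon>) *\<^sub>R a) ` L1_unit_ball \<subseteq> (\<lambda>y. y /\<^sub>R real n) ` discovered_region \<omega> n \<and>
      (\<lambda>y. y /\<^sub>R real n) ` discovered_region \<omega> n \<subseteq> (\<lambda>a. (1 + \<epsilon>) *\<^sub>R a) ` L1_unit_ball"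
    by (rule AE_uniform_measureI[OF sets_origin_occupied *])
qed

section \<open>Uniqueness of the limit shape\<close>

lemma emeasure_origin_occupied:
  fixes \<delta> :: real
  assumes tail: "\<forall>\<^sub>F n in sequentially. measure_pmf.prob \<mu> {k. k \<ge> n} \<ge> ln (real n) powr (- \<delta>)"
  shows "emeasure (frog_measure \<mu> p) {\<omega> \<in> space (frog_measure \<mu> p). init_particles \<omega> (0 :: 'd::finite site) \<ge> 1} \<noteq> 0"
proof -
  interpret I: prob_space "initial_measure \<mu> :: ('d site \<Rightarrow> nat) measure"
    by (rule prob_space_initial)
  let ?M = "motion_measure p :: (('d site \<times> nat \<times> nat \<Rightarrow> 'd site) \<times> _) measure"
  interpret M: prob_space ?M
    by (rule prob_space_motion)
  define X where "X = {\<eta>. \<forall>x\<in>{0 :: 'd site}. \<eta> x \<in> {1 :: nat..}}"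
  \<comment> \<open>From n = 2 on the logarithm is positive, and so is its power. A positive
    probability is essential: conditioned on a null event, every almost sure statement would be
    vacuous.\<close>
  from eventually_happens'[OF sequentially_bot eventually_conj[OF tail eventually_ge_at_top[of 2]]]
  obtain n where n: "2 \<le> n" "ln (real n) powr (- \<delta>) \<le> measure_pmf.prob \<mu> {k. k \<ge> n}" by auto
  have "0 < ln (real n) powr (- \<delta>)" using n(1) by simp
  also note n(2)
  also have "measure_pmf.prob \<mu> {k. k \<ge> n} \<le> measure_pmf.prob \<mu> {1..}"
    using n(1) by (intro measure_pmf.finite_measure_mono) auto
  also have "\<dots> = I.prob X"
    unfolding X_def initial_measure_def by (subst measure_PiM_pmf_Collect) auto
  finally have "0 < I.prob X" .
  moreover have "emeasure (frog_measure \<mu> p) {\<omega> \<in> space (frog_measure \<mu> p). init_particles \<omega> (0 :: 'd site) \<ge> 1} = I.prob X"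
  proof -
    have X: "X \<in> I.events" unfolding X_def initial_measure_def by (rule sets_PiM_pmf_Collect) simp
    have "{\<omega> \<in> space (frog_measure \<mu> p). init_particles \<omega> (0 :: 'd site) \<ge> 1} = X \<times> space ?M"
      by (auto simp: X_def frog_measure_def initial_measure_def space_pair_measure space_PiM init_particles_def)
    hence "emeasure (frog_measure \<mu> p) {\<omega> \<in> space (frog_measure \<mu> p). init_particles \<omega> (0 :: 'd site) \<ge> 1} =
        emeasure (frog_measure \<mu> p) (X \<times> space ?M)" by (rule arg_cong)
    also have "\<dots> = emeasure (initial_measure \<mu>) X * emeasure ?M (space ?M)"
      unfolding frog_measure_def by (rule M.emeasure_pair_measure_Times[OF X sets.top])
    also have "\<dots> = I.prob X"
      by (simp only: M.emeasure_space_1 I.emeasure_eq_measure mult_1_right)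
    finally show ?thesis .
  qed
  ultimately show ?thesis by simp
qed

text \<open>Squeezing the same discovered region between both shapes gives (1 - \<epsilon>) A inside
  (1 + \<epsilon>) B. Letting \<epsilon> tend to 0 and using that B is closed removes the
  factors.\<close>

lemma limit_shape_subset:
  fixes A B :: "(real ^ 'd::finite) set"
  assumes E: "emeasure (frog_measure \<mu> p) {\<omega> \<in> space (frog_measure \<mu> p). init_particles \<omega> (0 :: 'd site) \<ge> 1} \<noteq> 0"
    and A: "is_limit_shape \<mu> p A" and B: "is_limit_shape \<mu> p B"
  shows "A \<subseteq> B"
proof
  fix a assume a: "a \<in> A"
  let ?E = "{\<omega> \<in> space (frog_measure \<mu> p). init_particles \<omega> (0 :: 'd site) \<ge> 1}"
  interpret F: prob_space "frog_measure \<mu> p :: 'd sample measure"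
    unfolding frog_measure_def by (intro prob_space_pair prob_space_initial prob_space_PiM_pmf)
  interpret U: prob_space "uniform_measure (frog_measure \<mu> p) ?E"
    using E by (rule prob_space_uniform_measure) simp
  have in_B: "((1 - \<epsilon>) / (1 + \<epsilon>)) *\<^sub>R a \<in> B" if \<epsilon>: "0 < \<epsilon>" "\<epsilon> < 1" for \<epsilon>
  proof -
    let ?S = "\<lambda>\<omega> n. (\<lambda>y. y /\<^sub>R real n) ` discovered_region \<omega> n"
    from A \<epsilon> have "AE \<omega> in uniform_measure (frog_measure \<mu> p) ?E. \<forall>\<^sub>F n in sequentially.
        (\<lambda>a. (1 - \<epsilon>) *\<^sub>R a) ` A \<subseteq> ?S \<omega> n \<and> ?S \<omega> n \<subseteq> (\<lambda>a. (1 + \<epsilon>) *\<^sub>R a) ` A"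
      unfolding is_limit_shape_def by blast
    moreover from B \<epsilon> have "AE \<omega> in uniform_measure (frog_measure \<mu> p) ?E. \<forall>\<^sub>F n in sequentially.
        (\<lambda>a. (1 - \<epsilon>) *\<^sub>R a) ` B \<subseteq> ?S \<omega> n \<and> ?S \<omega> n \<subseteq> (\<lambda>a. (1 + \<epsilon>) *\<^sub>R a) ` B"
      unfolding is_limit_shape_def by blast
    ultimately have "AE \<omega> in uniform_measure (frog_measure \<mu> p) ?E.
        (\<lambda>a. (1 - \<epsilon>) *\<^sub>R a) ` A \<subseteq> (\<lambda>a. (1 + \<epsilon>) *\<^sub>R a) ` B"
    proof eventually_elim
      case (elim \<omega>)
      hence "\<forall>\<^sub>F n in sequentially. (\<lambda>a. (1 - \<epsilon>) *\<^sub>R a) ` A \<subseteq> (\<lambda>a. (1 + \<epsilon>) *\<^sub>R a) ` B"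
        by eventually_elim (meson order_trans)
      thus ?case by (simp only: eventually_const[OF sequentially_bot])
    qed
    \<comment> \<open>The inclusion involves neither n nor \<omega>, so holding almost surely in a
      probability space means holding outright.\<close>
    hence "(\<lambda>a. (1 - \<epsilon>) *\<^sub>R a) ` A \<subseteq> (\<lambda>a. (1 + \<epsilon>) *\<^sub>R a) ` B" by (simp only: U.AE_const)
    with a have "(1 - \<epsilon>) *\<^sub>R a \<in> (\<lambda>a. (1 + \<epsilon>) *\<^sub>R a) ` B" by (meson imageI subsetD)
    then obtain c where c: "c \<in> B" "(1 - \<epsilon>) *\<^sub>R a = (1 + \<epsilon>) *\<^sub>R c" by (rule imageE)
    have "((1 - \<epsilon>) / (1 + \<epsilon>)) *\<^sub>R a = inverse (1 + \<epsilon>) *\<^sub>R ((1 - \<epsilon>) *\<^sub>R a)"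
      by (simp add: divide_inverse mult.commute)
    also have "\<dots> = c" unfolding c(2) using \<epsilon> by simp
    finally show ?thesis using c(1) by (simp only:)
  qed
  have "closed B" using B by (simp add: is_limit_shape_def)
  \<comment> \<open>The values 1 / (k + 2) lie strictly between 0 and 1 for every k and tend to
    0.\<close>
  moreover have "((1 - 1 / (real k + 2)) / (1 + 1 / (real k + 2))) *\<^sub>R a \<in> B" for k
    by (rule in_B) auto
  moreover have "(\<lambda>k. ((1 - 1 / (real k + 2)) / (1 + 1 / (real k + 2))) *\<^sub>R a) \<longlonglongrightarrow> 1 *\<^sub>R a"
    by (intro tendsto_scaleR tendsto_const) real_asymp
  ultimately have "1 *\<^sub>R a \<in> B" by (rule closed_sequentially)
  thus "a \<in> B" by simp
qed

text \<open>The equivalence contains existence as well as uniqueness: the ball is shown to be a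
  limit shape, and two applications of \<open>limit_shape_subset\<close> identify any other limit
  shape with it.\<close>

theorem theorem1p3:
  fixes \<mu> :: "nat pmf" and p \<delta> :: real and A :: "(real ^ 'd::finite) set"
  assumes "0 < p" "p \<le> 1"
    and "0 < \<delta>" "\<delta> < real CARD('d)"
    and "\<forall>\<^sub>F n in sequentially. measure_pmf.prob \<mu> {k. k \<ge> n} \<ge> ln (real n) powr (- \<delta>)"
  shows "is_limit_shape \<mu> p A \<longleftrightarrow> A = L1_unit_ball"
proof
  note ball = L1_unit_ball_is_limit_shape[OF assms(1,2,4,5)]
  note occupied = emeasure_origin_occupied[OF assms(5)]
  assume "is_limit_shape \<mu> p A"
  thus "A = L1_unit_ball"
    using limit_shape_subset[OF occupied _ ball] limit_shape_subset[OF occupied ball] by blast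
next
  assume "A = L1_unit_ball"
  thus "is_limit_shape \<mu> p A" using L1_unit_ball_is_limit_shape[OF assms(1,2,4,5)] by simp
qed

end
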